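(* Let $a,b,\ell$ be positive integers, let $f\in\mathcal{L}_{([a]\times[b])\times[\ell]}(R^{a+b})$, and let $(x_1,y_1,z_1),(x_2,y_2,z_2)\in[a]\times[b]\times[\ell]$ be antipodes, i.e. $(x_2,y_2,z_2)=(a+1-x_1,\,b+1-y_1,\,\ell+1-z_1)$. Then, as multisets, \[\mathrm{Dist}(f,(x_2,y_2,z_2))=\{a+b+1-m : m\in \mathrm{Dist}(f,(x_1,y_1,z_1))\}.\]
   Context: For a finite poset $P$ and positive integer $\ell$, let $[\ell]=\{1<\dots<\ell\}$ and for $p\in P$ let the fiber be $F_p=\{(p,i):1\le i\le \ell\}$. Given $R$ assigning to each $p\in P$ a finite nonempty set $R(p)\subset\mathbb{Z}$, a $P$-strict labeling of $P\times[\ell]$ with restriction function $R$ is a map $f:P\times[\ell]\to\mathbb{Z}$ with (1) $f(p_1,i)<f(p_2,i)$ whenever $p_1<_P p_2$; (2) $f(p,i_1)\le f(p,i_2)$ whenever $i_1\le i_2$; (3) $f(p,i)\in R(p)$. The set of these is $\mathcal{L}_{P\times[\ell]}(R)$. For a positive integer $q$, $R^q(p)$ is the set of $k$ such that some map $g:P\to\{1,\dots,q\}$ with $g(p_1)<g(p_2)$ whenever $p_1<_Pp_2$ has $g(p)=k$. Here $P=[a]\times[b]$ (componentwise order), so $R^{a+b}((x,y))=\{x+y-1,x+y\}$; elements of $([a]\times[b])\times[\ell]$ are written $(x,y,z)$. Promotion: let $R(p)_{>k}$ be the smallest element of $R(p)$ larger than $k$. A label $f(p,i)$ is raisable (resp.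 lowerable) if there is $g\in\mathcal{L}_{P\times[\ell]}(R)$ with $f(p,i)<g(p,i)$ (resp. $f(p,i)>g(p,i)$) and $f(p',i')=g(p',i')$ for all $(p',i')$ with $p'\neq p$. The Bender–Knuth involution $\rho_k$: call raisable labels equal to $k$ and lowerable labels equal to $R(p)_{>k}$ free; if the free labels in fiber $F_p$ are $\alpha$ copies of $k$ followed by $\beta$ copies of $R(p)_{>k}$, $\rho_k$ replaces them by $\beta$ copies of $k$ followed by $\alpha$ copies of $R(p)_{>k}$. Promotion is $\mathrm{Pro}=\cdots\circ\rho_3\circ\rho_2\circ\rho_1\circ\cdots$ (applied in increasing order of $k$; only finitely many $\rho_k$ act nontrivially). For a point $p$ of $[a]\times[b]\times[\ell]$, $\mathrm{Dist}(f,p)$ is the multiset $\{\mathrm{Pro}^i(f)(p):0\le i\le a+b-1\}$. *)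

theory Defs
  imports "HOL-Library.Product_Order" "HOL-Library.FuncSet" "HOL-Library.Multiset"
begin

text \<open>
  A finite poset is a finite subset \<open>P\<close> of an order type, with the induced order. A labeling of
  \<open>P \<times> [\<ell>]\<close> is extended by \<open>undefined\<close> outside its domain (\<open>PiE\<close>), so that equality of
  labelings is equality on \<open>P \<times> [\<ell>]\<close>.
\<close>

definition strict_labelings ::
  "'p::order set \<Rightarrow> nat \<Rightarrow> ('p \<Rightarrow> int set) \<Rightarrow> ('p \<times> nat \<Rightarrow> int) set" where
  "strict_labelings P l R =
     {f \<in> PiE (P \<times> {1..l}) (\<lambda>(p, i). R p).
        (\<forall>p\<^sub>1\<in>P. \<forall>p\<^sub>2\<in>P. \<forall>i\<in>{1..l}. p\<^sub>1 < p\<^sub>2 \<longrightarrow> f (p\<^sub>1, i) < f (p\<^sub>2, i)) \<and>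
        (\<forall>p\<in>P. \<forall>i\<^sub>1\<in>{1..l}. \<forall>i\<^sub>2\<in>{1..l}. i\<^sub>1 \<le> i\<^sub>2 \<longrightarrow> f (p, i\<^sub>1) \<le> f (p, i\<^sub>2))}"

definition bounded_restriction :: "'p::order set \<Rightarrow> nat \<Rightarrow> 'p \<Rightarrow> int set" where
  "bounded_restriction P q p =
     {k. \<exists>g. g \<in> P \<rightarrow> {1..int q} \<and>
             (\<forall>p\<^sub>1\<in>P. \<forall>p\<^sub>2\<in>P. p\<^sub>1 < p\<^sub>2 \<longrightarrow> g p\<^sub>1 < g p\<^sub>2) \<and> g p = k}"

definition raisable ::
  "'p::order set \<Rightarrow> nat \<Rightarrow> ('p \<Rightarrow> int set) \<Rightarrow> ('p \<times> nat \<Rightarrow> int) \<Rightarrow> 'p \<times> nat \<Rightarrow> bool" where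
  "raisable P l R f = (\<lambda>(p, i). \<exists>g\<in>strict_labelings P l R.
     f (p, i) < g (p, i) \<and> (\<forall>p'\<in>P. \<forall>i'\<in>{1..l}. p' \<noteq> p \<longrightarrow> f (p', i') = g (p', i')))"

definition lowerable ::
  "'p::order set \<Rightarrow> nat \<Rightarrow> ('p \<Rightarrow> int set) \<Rightarrow> ('p \<times> nat \<Rightarrow> int) \<Rightarrow> 'p \<times> nat \<Rightarrow> bool" where
  "lowerable P l R f = (\<lambda>(p, i). \<exists>g\<in>strict_labelings P l R.
     f (p, i) > g (p, i) \<and> (\<forall>p'\<in>P. \<forall>i'\<in>{1..l}. p' \<noteq> p \<longrightarrow> f (p', i') = g (p', i')))"

text \<open>The element \<open>R(p)\<^sub>>\<^sub>k\<close> for \<open>A = R(p)\<close>; only meaningful if \<open>A\<close> has an element larger than \<open>k\<close>.\<close>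

definition next_above :: "int set \<Rightarrow> int \<Rightarrow> int" where
  "next_above A k = Min {m \<in> A. k < m}"

text \<open>
  Positions in the fiber over \<open>p\<close> of the free labels equal to \<open>k\<close>, respectively to
  \<open>next_above (R p) k\<close>. A fiber with \<open>k \<notin> R p\<close>, or on which \<open>k\<close> is the largest allowed
  label, has no free labels.
\<close>

definition free_low ::
  "'p::order set \<Rightarrow> nat \<Rightarrow> ('p \<Rightarrow> int set) \<Rightarrow> int \<Rightarrow> ('p \<times> nat \<Rightarrow> int) \<Rightarrow> 'p \<Rightarrow> nat set" where
  "free_low P l R k f p =
     {i \<in> {1..l}. k \<in> R p \<and> (\<exists>m\<in>R p. k < m) \<and> f (p, i) = k \<and> raisable P l R f (p, i)}"

definition free_high ::
  "'p::order set \<Rightarrow> nat \<Rightarrow> ('p \<Rightarrow> int set) \<Rightarrow> int \<Rightarrow> ('p \<times> nat \<Rightarrow> int) \<Rightarrow> 'p \<Rightarrow> nat set" where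
  "free_high P l R k f p =
     {i \<in> {1..l}. k \<in> R p \<and> (\<exists>m\<in>R p. k < m) \<and>
        f (p, i) = next_above (R p) k \<and> lowerable P l R f (p, i)}"

text \<open>
  With \<open>\<alpha> = card (free_low \<dots>)\<close> and \<open>\<beta> = card (free_high \<dots>)\<close>, the first \<open>\<beta>\<close> of the
  \<open>\<alpha> + \<beta>\<close> free positions of a fiber receive \<open>k\<close> and the remaining \<open>\<alpha>\<close> receive
  \<open>next_above (R p) k\<close>.
\<close>

definition bender_knuth ::
  "'p::order set \<Rightarrow> nat \<Rightarrow> ('p \<Rightarrow> int set) \<Rightarrow> int \<Rightarrow> ('p \<times> nat \<Rightarrow> int) \<Rightarrow> ('p \<times> nat \<Rightarrow> int)" where
  "bender_knuth P l R k f = (\<lambda>(p, i).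
     let free = free_low P l R k f p \<union> free_high P l R k f p in
     if p \<in> P \<and> i \<in> free
     then if card {j \<in> free. j \<le> i} \<le> card (free_high P l R k f p)
          then k else next_above (R p) k
     else f (p, i))"

lemma bender_knuth_trivial:
  assumes "k \<notin> (\<Union>p\<in>P. R p)"
  shows "bender_knuth P l R k f = f"
  using assms by (intro ext) (auto simp: bender_knuth_def free_low_def free_high_def Let_def)

text \<open>
  By the preceding lemma, composing over the integers between the smallest and the largest
  allowed label, in increasing order, is the same as composing over all integers.
\<close>

definition promotion ::
  "'p::order set \<Rightarrow> nat \<Rightarrow> ('p \<Rightarrow> int set) \<Rightarrow> ('p \<times> nat \<Rightarrow> int) \<Rightarrow> ('p \<times> nat \<Rightarrow> int)" where
  "promotion P l R =
     fold (bender_knuth P l R) [Min (\<Union>p\<in>P. R p)..Max (\<Union>p\<in>P. R p)]"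

text \<open>\<open>[a] \<times> [b]\<close>; the order on pairs is the componentwise one of \<open>Product_Order\<close>.\<close>

definition grid :: "nat \<Rightarrow> nat \<Rightarrow> (nat \<times> nat) set" where
  "grid a b = {1..a} \<times> {1..b}"

definition grid_restriction :: "nat \<Rightarrow> nat \<Rightarrow> nat \<times> nat \<Rightarrow> int set" where
  "grid_restriction a b = bounded_restriction (grid a b) (a + b)"

text \<open>A point \<open>(x, y, z)\<close> is represented as \<open>((x, y), z)\<close>.\<close>

definition label_dist ::
  "nat \<Rightarrow> nat \<Rightarrow> nat \<Rightarrow> ((nat \<times> nat) \<times> nat \<Rightarrow> int) \<Rightarrow> (nat \<times> nat) \<times> nat \<Rightarrow> int multiset" where
  "label_dist a b l f v =
     image_mset (\<lambda>i. (promotion (grid a b) l (grid_restriction a b) ^^ i) f v)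
       (mset_set {0..a + b - 1})"

end

theory Submission
  imports Defs Complex_Main
begin

text \<open>
  A labeling is determined by the numbers \<open>c (x, y)\<close> of labels \<open>x + y - 1\<close> in the fibers; they form a
  plane partition with entries in \<open>{0..l}\<close>, on which promotion acts as piecewise-linear rowmotion:
  \<open>c'(v) + c(v)\<close> is the minimum of \<open>c'\<close> over the lower neighbours of \<open>v\<close> plus the maximum of
  \<open>c\<close> over its upper neighbours. The theorem follows from the reciprocity
  \<open>c\<^sub>t(x, y) + c\<^sub>t\<^sub>+\<^sub>x\<^sub>+\<^sub>y\<^sub>-\<^sub>1(a + 1 - x, b + 1 - y) = l\<close>, which also gives the period \<open>a + b\<close>.

  Reciprocity is proved for birational rowmotion on positive reals, of which the piecewise-linear
  one is the tropical limit. There the values are sums over lattice paths weighted by slacks, and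
  one step turns upper slacks into lower slacks. Moving a jump along a path shows that the path
  sums between the two edges \<open>y = 1\<close> and \<open>y = b\<close> are invariant under a diagonal shift combined with
  this exchange of slacks; this is reciprocity on the edges. It spreads to the interior by
  cancelling in the recurrence at \<open>v\<close> and at its antipode, which would be impossible with
  minima and maxima.
\<close>

section \<open>Covers and rank in the grid\<close>

definition cov :: "nat \<times> nat \<Rightarrow> nat \<times> nat \<Rightarrow> bool" where
  "cov v w \<longleftrightarrow> w = (Suc (fst v), snd v) \<or> w = (fst v, Suc (snd v))"

definition rk :: "nat \<times> nat \<Rightarrow> nat" where
  "rk v = fst v + snd v"

lemma cov_rk: "cov v w \<Longrightarrow> rk w = Suc (rk v)"
  by (auto simp: cov_def rk_def)

lemma grid_iff [simp]: "(x, y) \<in> grid a b \<longleftrightarrow> 1 \<le> x \<and> x \<le> a \<and> 1 \<le> y \<and> y \<le> b"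
  by (auto simp: grid_def)

lemma finite_grid [simp]: "finite (grid a b)"
  by (simp add: grid_def)

subsection \<open>Birational rowmotion on a rectangle\<close>

locale rectangle =
  fixes a b :: nat
  assumes a_pos: "1 \<le> a" and b_pos: "1 \<le> b"
begin

abbreviation "G \<equiv> grid a b"

section \<open>Neighbour sums and lattice path sums\<close>

definition upsum :: "(nat \<times> nat \<Rightarrow> real) \<Rightarrow> nat \<times> nat \<Rightarrow> real" where
  "upsum f v = (\<Sum>w\<in>G. of_bool (cov v w) * f w)"

definition downsum :: "(nat \<times> nat \<Rightarrow> real) \<Rightarrow> nat \<times> nat \<Rightarrow> real" where
  "downsum f v = (\<Sum>w\<in>G. of_bool (cov w v) * f w)"

text \<open>
  Sums over the lattice paths with \<open>n\<close> steps from \<open>d\<close> to \<open>v\<close>, respectively from \<open>v\<close> to \<open>u\<close>. The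
  weight of \<open>v\<close> itself is left out in both.
\<close>

primrec paths_from :: "(nat \<times> nat \<Rightarrow> real) \<Rightarrow> nat \<times> nat \<Rightarrow> nat \<Rightarrow> nat \<times> nat \<Rightarrow> real" where
  "paths_from W d 0 v = of_bool (v = d)"
| "paths_from W d (Suc n) v = downsum (\<lambda>w. W w * paths_from W d n w) v"

primrec paths_to :: "(nat \<times> nat \<Rightarrow> real) \<Rightarrow> nat \<times> nat \<Rightarrow> nat \<Rightarrow> nat \<times> nat \<Rightarrow> real" where
  "paths_to W u 0 v = of_bool (v = u)"
| "paths_to W u (Suc n) v = upsum (\<lambda>w. W w * paths_to W u n w) v"

lemma paths_to_cong:
  "(\<And>w. w \<in> G \<Longrightarrow> W w = W' w) \<Longrightarrow> paths_to W u n v = paths_to W' u n v"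
  by (induction n arbitrary: v) (auto simp: upsum_def intro!: sum.cong)

lemma sum_delta_cov:
  "(\<Sum>w\<in>G. of_bool (w = p \<or> w = q) * f w) =
     (if p \<in> G then f p else 0) + (if q \<in> G \<and> q \<noteq> p then f q else (0::real))"
proof -
  have "(\<Sum>w\<in>G. of_bool (w = p \<or> w = q) * f w) = sum f (G \<inter> {p, q})"
    by (subst sum.inter_restrict) (auto intro!: sum.cong)
  also have "G \<inter> {p, q} = (if p \<in> G then {p} else {}) \<union> (if q \<in> G \<and> q \<noteq> p then {q} else {})"
    by auto
  finally show ?thesis
    by auto
qed

lemma upsum_eq:
  assumes "(x, y) \<in> G"
  shows "upsum f (x, y) =
    (if x < a then f (Suc x, y) else 0) + (if y < b then f (x, Suc y) else 0)"
  unfolding upsum_def cov_def sum_delta_cov using assms by auto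

lemma downsum_eq:
  assumes "(x, y) \<in> G"
  shows "downsum f (x, y) =
    (if 1 < x then f (x - 1, y) else 0) + (if 1 < y then f (x, y - 1) else 0)"
proof -
  have "cov w (x, y) \<longleftrightarrow> w = (x - 1, y) \<or> w = (x, y - 1)" if "w \<in> G" for w
    using that assms by (cases w) (auto simp: cov_def)
  then have "downsum f (x, y) = (\<Sum>w\<in>G. of_bool (w = (x - 1, y) \<or> w = (x, y - 1)) * f w)"
    unfolding downsum_def by (intro sum.cong) auto
  then show ?thesis
    unfolding sum_delta_cov using assms by (auto split: if_splits)
qed

lemma upsum_pos:
  assumes "v \<in> G" "v \<noteq> (a, b)" "\<And>w. w \<in> G \<Longrightarrow> f w > 0"
  shows "upsum f v > 0"
proof (cases v)
  case (Pair x y)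
  then show ?thesis
    using assms(1,2) by (auto simp: upsum_eq intro!: add_pos_pos assms(3))
qed

lemma downsum_pos:
  assumes "v \<in> G" "v \<noteq> (1, 1)" "\<And>w. w \<in> G \<Longrightarrow> f w > 0"
  shows "downsum f v > 0"
proof (cases v)
  case (Pair x y)
  then show ?thesis
    using assms(1,2) by (auto simp: downsum_eq intro!: add_pos_pos assms(3))
qed

text \<open>Cut every path at a fixed level: all cuts give the same sum.\<close>

lemma paths_from_to:
  assumes "d \<in> G" "u \<in> G"
  shows "paths_from W d n u * W u = W d * paths_to W u n d"
proof -
  define C where "C n m = (\<Sum>v\<in>G. paths_from W d n v * W v * paths_to W u m v)" for n m
  have "C (Suc n) m = C n (Suc m)" for n m
  proof -
    have "C (Suc n) m = (\<Sum>v\<in>G. \<Sum>w\<in>G. of_bool (cov w v) * W w * paths_from W d n w * W v * paths_to W u m v)"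
      by (simp add: C_def downsum_def sum_distrib_left sum_distrib_right mult_ac
        del: sum_of_bool_mult_eq sum_mult_of_bool_eq)
    also have "\<dots> = (\<Sum>w\<in>G. \<Sum>v\<in>G. of_bool (cov w v) * W w * paths_from W d n w * W v * paths_to W u m v)"
      by (rule sum.swap)
    also have "\<dots> = C n (Suc m)"
      by (simp add: C_def upsum_def sum_distrib_left sum_distrib_right mult_ac
        del: sum_of_bool_mult_eq sum_mult_of_bool_eq)
    finally show ?thesis .
  qed
  then have "C (n + m) 0 = C m n" for m
    by (induction n arbitrary: m) (auto simp flip: add_Suc_right)
  from this[of 0] have "C n 0 = C 0 n"
    by simp
  moreover have "C n 0 = (\<Sum>v\<in>G. if v = u then paths_from W d n v * W v else 0)"
    unfolding C_def by (intro sum.cong) auto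
  then have "C n 0 = paths_from W d n u * W u"
    using assms by simp
  moreover have "C 0 n = (\<Sum>v\<in>G. if v = d then W v * paths_to W u n v else 0)"
    unfolding C_def by (intro sum.cong) auto
  then have "C 0 n = W d * paths_to W u n d"
    using assms by simp
  ultimately show ?thesis
    by simp
qed

section \<open>Slacks and the path sums that recover the values\<close>

definition up :: "(nat \<times> nat \<Rightarrow> real) \<Rightarrow> nat \<times> nat \<Rightarrow> real" where
  "up f v = (if v = (a, b) then 1 else upsum f v)"

text \<open>The inverse of a sum of inverses is the birational counterpart of a minimum, as the sum
  in \<open>up\<close> is of a maximum. The corner values 1 and \<open>L\<close> become 0 and
  \<open>l\<close> in the tropical limit.\<close>

definition down :: "real \<Rightarrow> (nat \<times> nat \<Rightarrow> real) \<Rightarrow> nat \<times> nat \<Rightarrow> real" where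
  "down L f v = (if v = (1, 1) then L else inverse (downsum (\<lambda>w. inverse (f w)) v))"

definition upslack :: "(nat \<times> nat \<Rightarrow> real) \<Rightarrow> nat \<times> nat \<Rightarrow> real" where
  "upslack f v = f v / up f v"

definition downslack :: "real \<Rightarrow> (nat \<times> nat \<Rightarrow> real) \<Rightarrow> nat \<times> nat \<Rightarrow> real" where
  "downslack L f v = down L f v / f v"

lemma up_pos:
  assumes "v \<in> G" "\<And>w. w \<in> G \<Longrightarrow> f w > 0"
  shows "up f v > 0"
  using upsum_pos[OF assms(1) _ assms(2)] by (auto simp: up_def)

lemma down_pos:
  assumes "v \<in> G" "\<And>w. w \<in> G \<Longrightarrow> f w > 0" "L > 0"
  shows "down L f v > 0"
  using downsum_pos[OF assms(1), of "\<lambda>w. inverse (f w)"] assms(2,3) by (auto simp: down_def)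

text \<open>A value is its slack times the sum of its upper neighbours. Unfolding this up to
  \<open>(a, b)\<close>, where \<open>up\<close> is 1, yields one term per lattice path, and all
  these paths have \<open>n\<close> steps.\<close>

lemma upslack_paths:
  assumes pos: "\<And>w. w \<in> G \<Longrightarrow> f w > 0" and v: "v \<in> G" and n: "rk v + n = a + b"
  shows "f v = upslack f v * paths_to (upslack f) (a, b) n v"
  using v n
proof (induction n arbitrary: v)
  case 0
  then have "v = (a, b)"
    by (cases v) (auto simp: rk_def)
  then show ?case
    by (simp add: upslack_def up_def)
next
  case (Suc n)
  have ne: "v \<noteq> (a, b)"
    using Suc.prems by (auto simp: rk_def)
  have "upsum (\<lambda>w. upslack f w * paths_to (upslack f) (a, b) n w) v = upsum f v"
    unfolding upsum_def
  proof (intro sum.cong refl)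
    fix w assume "w \<in> G"
    then show "of_bool (cov v w) * (upslack f w * paths_to (upslack f) (a, b) n w)
        = of_bool (cov v w) * f w"
      using Suc.IH[of w] Suc.prems cov_rk[of v w] by (cases "cov v w") auto
  qed
  moreover have "upsum f v > 0"
    using upsum_pos Suc.prems(1) ne pos by blast
  moreover have "upslack f v = f v / upsum f v"
    using ne by (simp add: upslack_def up_def)
  ultimately show ?case
    by simp
qed

text \<open>Reciprocals unfold downwards: away from \<open>(1, 1)\<close>,
  \<open>inverse (f v)\<close> is the lower slack times the sum of the reciprocals below. At
  \<open>(1, 1)\<close> the lower slack is \<open>L / f v\<close>, which produces the factor
  \<open>L\<close>.\<close>

lemma downslack_paths:
  assumes pos: "\<And>w. w \<in> G \<Longrightarrow> f w > 0" and v: "v \<in> G" and n: "rk v = n + 2"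
  shows "L / f v = paths_from (downslack L f) (1, 1) n v * downslack L f v"
  using v n
proof (induction n arbitrary: v)
  case 0
  then have "v = (1, 1)"
    by (cases v) (auto simp: rk_def)
  then show ?case
    by (simp add: downslack_def down_def)
next
  case (Suc n)
  have ne: "v \<noteq> (1, 1)"
    using Suc.prems by (auto simp: rk_def)
  have "downsum (\<lambda>w. downslack L f w * paths_from (downslack L f) (1, 1) n w) v
      = downsum (\<lambda>w. L * inverse (f w)) v"
    unfolding downsum_def
  proof (intro sum.cong refl)
    fix w assume "w \<in> G"
    then show "of_bool (cov w v) * (downslack L f w * paths_from (downslack L f) (1, 1) n w)
        = of_bool (cov w v) * (L * inverse (f w))"
      using Suc.IH[of w] Suc.prems cov_rk[of w v]
      by (cases "cov w v") (auto simp: field_simps)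
  qed
  also have "\<dots> = L * downsum (\<lambda>w. inverse (f w)) v"
    by (simp add: downsum_def sum_distrib_left mult_ac del: sum_of_bool_mult_eq sum_mult_of_bool_eq)
  moreover have "downsum (\<lambda>w. inverse (f w)) v > 0"
    using downsum_pos[of v "\<lambda>w. inverse (f w)"] Suc.prems(1) ne pos by simp
  moreover have "downslack L f v = inverse (downsum (\<lambda>w. inverse (f w)) v) / f v"
    using ne by (simp add: downslack_def down_def)
  ultimately show ?case
    using pos[OF Suc.prems(1)] by (simp add: field_simps)
qed

text \<open>
  The conversion lemma below interpolates between the two path sums by paths that climb with upper
  slacks to some \<open>v\<close>, jump with weight \<open>f v / f z\<close> to any \<open>z\<close> on the next antidiagonal that is not
  higher than \<open>v\<close>, and continue from \<open>z\<close> with lower slacks. The next identity moves the jump by one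
  step; from \<open>y = 1\<close> and into \<open>y = b\<close> only the horizontal jump is possible.
\<close>

lemma jump_local:
  assumes pos: "\<And>w. w \<in> G \<Longrightarrow> f w > 0" and v: "v \<in> G" and z: "z \<in> G" and rk: "rk z = rk v + 2"
  shows "upslack f v * inverse (f z) * (\<Sum>w\<in>G. of_bool (cov v w \<and> snd z \<le> snd w) * f w) =
    f v * downslack L f z * (\<Sum>w\<in>G. of_bool (cov w z \<and> snd w \<le> snd v) * inverse (f w))"
proof -
  have ne: "v \<noteq> (a, b)" "z \<noteq> (1, 1)"
    using v z rk by (auto simp: rk_def grid_def)
  have up: "upslack f v = f v / upsum f v" and usp: "upsum f v > 0"
    using upsum_pos[OF v ne(1) pos] ne by (auto simp: upslack_def up_def)
  have down: "downslack L f z = inverse (downsum (\<lambda>w. inverse (f w)) z) / f z"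
    and dsp: "downsum (\<lambda>w. inverse (f w)) z > 0"
    using downsum_pos[OF z ne(2), of "\<lambda>w. inverse (f w)"] pos ne by (auto simp: downslack_def down_def)
  obtain x y where vxy: "v = (x, y)"
    by (cases v)
  obtain x' y' where zxy: "z = (x', y')"
    by (cases z)
  \<comment> \<open>Both sides are \<open>f v / f z\<close> times a fraction: 1 if \<open>z\<close>
    is not higher than \<open>v\<close>, 0 if it is higher by more than one. In between, one
    neighbour of each point survives, and the fraction is the share of \<open>f (x, Suc y)\<close>
    in \<open>upsum f v\<close>.\<close>
  consider "y' \<le> y" | "y' = Suc y" | "y' > Suc y"
    by linarith
  then show ?thesis
  proof cases
    case 1
    have "(\<Sum>w\<in>G. of_bool (cov v w \<and> snd z \<le> snd w) * f w) = upsum f v"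
      unfolding upsum_def using 1 by (intro sum.cong) (auto simp: cov_def vxy zxy)
    moreover have "(\<Sum>w\<in>G. of_bool (cov w z \<and> snd w \<le> snd v) * inverse (f w))
        = downsum (\<lambda>w. inverse (f w)) z"
      unfolding downsum_def using 1 by (intro sum.cong) (auto simp: cov_def vxy zxy)
    ultimately show ?thesis
      using usp dsp by (simp add: up down field_simps)
  next
    case 2
    then have x': "x' = Suc x"
      using rk by (simp add: vxy zxy rk_def)
    have "(\<Sum>w\<in>G. of_bool (cov v w \<and> snd z \<le> snd w) * f w)
        = (\<Sum>w\<in>G. if w = (x, Suc y) then f w else 0)"
      using 2 by (intro sum.cong) (auto simp: cov_def vxy zxy)
    also have "\<dots> = f (x, Suc y)"
      using v z 2 by (simp add: vxy zxy x')
    finally have s1: "(\<Sum>w\<in>G. of_bool (cov v w \<and> snd z \<le> snd w) * f w) = f (x, Suc y)" .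
    have "(\<Sum>w\<in>G. of_bool (cov w z \<and> snd w \<le> snd v) * inverse (f w))
        = (\<Sum>w\<in>G. if w = (Suc x, y) then inverse (f w) else 0)"
      using 2 x' by (intro sum.cong) (auto simp: cov_def vxy zxy)
    also have "\<dots> = inverse (f (Suc x, y))"
      using v z 2 by (simp add: vxy zxy x')
    finally have s2: "(\<Sum>w\<in>G. of_bool (cov w z \<and> snd w \<le> snd v) * inverse (f w))
        = inverse (f (Suc x, y))" .
    have us: "upsum f v = f (Suc x, y) + f (x, Suc y)"
      using v z 2 by (simp add: vxy zxy x' upsum_eq)
    have ds: "downsum (\<lambda>w. inverse (f w)) z = inverse (f (x, Suc y)) + inverse (f (Suc x, y))"
      using v z 2 by (simp add: vxy zxy x' downsum_eq)
    have "f (x, Suc y) > 0" "f (Suc x, y) > 0" "f v > 0" "f z > 0"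
      using pos v z 2 by (simp_all add: vxy zxy x')
    then show ?thesis
      unfolding s1 s2 up down us ds by (simp add: divide_simps)
  next
    case 3
    have "(\<Sum>w\<in>G. of_bool (cov v w \<and> snd z \<le> snd w) * f w) = 0"
      using 3 by (intro sum.neutral) (auto simp: cov_def vxy zxy)
    moreover have "(\<Sum>w\<in>G. of_bool (cov w z \<and> snd w \<le> snd v) * inverse (f w)) = 0"
      using 3 by (intro sum.neutral) (auto simp: cov_def vxy zxy)
    ultimately show ?thesis
      by simp
  qed
qed

lemma conversion:
  assumes pos: "\<And>w. w \<in> G \<Longrightarrow> f w > 0" and i: "1 \<le> i" "i < a" and k: "1 \<le> k" "k < a"
  shows "downslack L f (Suc i, 1) * paths_to (downslack L f) (Suc k, b) n (Suc i, 1) =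
    upslack f (i, 1) * paths_to (upslack f) (k, b) n (i, 1)"
proof -
  let ?V = "upslack f" and ?A = "downslack L f"
  define J where "J v z \<longleftrightarrow> rk z = rk v + 1 \<and> snd z \<le> snd v" for v z
  define S where "S n m = (\<Sum>v\<in>G. \<Sum>z\<in>G. of_bool (J v z) * paths_from ?V (i, 1) n v * f v *
     inverse (f z) * paths_to ?A (Suc k, b) m z)" for n m
  have "S (Suc n) m = S n (Suc m)" for n m
  proof -
    let ?p = "paths_from ?V (i, 1) n" and ?q = "paths_to ?A (Suc k, b) m"
    have "S (Suc n) m = (\<Sum>w\<in>G. \<Sum>z\<in>G. \<Sum>v\<in>G. of_bool (J w z) * of_bool (cov v w) * ?V v * ?p v * f w *
         inverse (f z) * ?q z)"
      by (simp add: S_def downsum_def sum_distrib_left sum_distrib_right mult_ac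
        del: sum_of_bool_mult_eq sum_mult_of_bool_eq)
    also have "\<dots> = (\<Sum>w\<in>G. \<Sum>v\<in>G. \<Sum>z\<in>G. of_bool (J w z) * of_bool (cov v w) * ?V v * ?p v * f w *
         inverse (f z) * ?q z)"
      by (rule sum.cong[OF refl], rule sum.swap)
    also have "\<dots> = (\<Sum>v\<in>G. \<Sum>w\<in>G. \<Sum>z\<in>G. of_bool (J w z) * of_bool (cov v w) * ?V v * ?p v * f w *
         inverse (f z) * ?q z)"
      by (rule sum.swap)
    also have "\<dots> = (\<Sum>v\<in>G. \<Sum>z\<in>G. \<Sum>w\<in>G. of_bool (J w z) * of_bool (cov v w) * ?V v * ?p v * f w *
         inverse (f z) * ?q z)"
      by (rule sum.cong[OF refl], rule sum.swap)
    \<comment> \<open>With the ends \<open>v\<close> and \<open>z\<close> fixed, only pairs two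
      antidiagonals apart contribute; for them \<open>jump_local\<close> trades a step followed by
      the jump for the jump followed by a step.\<close>
    also have "\<dots> = (\<Sum>v\<in>G. \<Sum>z\<in>G. \<Sum>w\<in>G. of_bool (J v w) * of_bool (cov w z) * ?A z * ?p v * f v *
         inverse (f w) * ?q z)"
    proof (rule sum.cong[OF refl], rule sum.cong[OF refl])
      fix v z assume vz: "v \<in> G" "z \<in> G"
      show "(\<Sum>w\<in>G. of_bool (J w z) * of_bool (cov v w) * ?V v * ?p v * f w * inverse (f z) * ?q z) =
        (\<Sum>w\<in>G. of_bool (J v w) * of_bool (cov w z) * ?A z * ?p v * f v * inverse (f w) * ?q z)"
      proof (cases "rk z = rk v + 2")
        case True
        have 1: "(\<Sum>w\<in>G. of_bool (J w z) * of_bool (cov v w) * ?V v * ?p v * f w * inverse (f z) * ?q z)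
          = ?p v * ?q z * (?V v * inverse (f z) * (\<Sum>w\<in>G. of_bool (cov v w \<and> snd z \<le> snd w) * f w))"
          unfolding sum_distrib_left using True
          by (intro sum.cong) (auto simp: J_def dest!: cov_rk)
        have 2: "(\<Sum>w\<in>G. of_bool (J v w) * of_bool (cov w z) * ?A z * ?p v * f v * inverse (f w) * ?q z)
          = ?p v * ?q z * (f v * ?A z * (\<Sum>w\<in>G. of_bool (cov w z \<and> snd w \<le> snd v) * inverse (f w)))"
          unfolding sum_distrib_left using True
          by (intro sum.cong) (auto simp: J_def dest!: cov_rk)
        show ?thesis
          unfolding 1 2 by (subst jump_local[OF pos vz True]) auto
      next
        case False
        then show ?thesis
          by (intro trans[OF sum.neutral sum.neutral[symmetric]]) (auto simp: J_def dest!: cov_rk)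
      qed
    qed
    also have "\<dots> = (\<Sum>v\<in>G. \<Sum>w\<in>G. \<Sum>z\<in>G. of_bool (J v w) * of_bool (cov w z) * ?A z * ?p v * f v *
         inverse (f w) * ?q z)"
      by (rule sum.cong[OF refl], rule sum.swap)
    also have "\<dots> = S n (Suc m)"
      by (simp add: S_def upsum_def sum_distrib_left sum_distrib_right mult_ac
        del: sum_of_bool_mult_eq sum_mult_of_bool_eq)
    finally show ?thesis .
  qed
  then have "S (n + m) 0 = S m n" for m
    by (induction n arbitrary: m) (auto simp flip: add_Suc_right)
  from this[of 0] have S: "S n 0 = S 0 n"
    by simp
  have "S 0 n = (\<Sum>v\<in>G. if v = (i, 1) then (\<Sum>z\<in>G. of_bool (J v z) * f v *
     inverse (f z) * paths_to ?A (Suc k, b) n z) else 0)"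
    unfolding S_def by (intro sum.cong) auto
  also have "\<dots> = (\<Sum>z\<in>G. of_bool (J (i, 1) z) * f (i, 1) * inverse (f z) * paths_to ?A (Suc k, b) n z)"
    using i b_pos by simp
  also have "\<dots> = (\<Sum>z\<in>G. if z = (Suc i, 1) then f (i, 1) * inverse (f z) * paths_to ?A (Suc k, b) n z else 0)"
    by (intro sum.cong) (auto simp: J_def rk_def)
  also have "\<dots> = f (i, 1) * inverse (f (Suc i, 1)) * paths_to ?A (Suc k, b) n (Suc i, 1)"
    using i b_pos by simp
  \<comment> \<open>\<open>(i, 1)\<close> is the only lower neighbour of \<open>(Suc i, 1)\<close>,
    so the jump weight is itself a slack; the same happens on the edge \<open>y = b\<close> with an
    upper slack.\<close>
  also have "f (i, 1) * inverse (f (Suc i, 1)) = ?A (Suc i, 1)"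
    using i b_pos by (simp add: downslack_def down_def downsum_eq field_simps)
  finally have S0: "S 0 n = ?A (Suc i, 1) * paths_to ?A (Suc k, b) n (Suc i, 1)" .
  have "S n 0 = (\<Sum>v\<in>G. \<Sum>z\<in>G. if z = (Suc k, b) then of_bool (J v z) * paths_from ?V (i, 1) n v * f v *
     inverse (f z) else 0)"
    unfolding S_def by (intro sum.cong) auto
  also have "\<dots> = (\<Sum>v\<in>G. of_bool (J v (Suc k, b)) * paths_from ?V (i, 1) n v * f v * inverse (f (Suc k, b)))"
    using k b_pos by simp
  also have "\<dots> = (\<Sum>v\<in>G. if v = (k, b) then paths_from ?V (i, 1) n v * f v * inverse (f (Suc k, b)) else 0)"
    by (intro sum.cong) (auto simp: J_def rk_def grid_def)
  also have "\<dots> = paths_from ?V (i, 1) n (k, b) * (f (k, b) * inverse (f (Suc k, b)))"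
    using k b_pos by simp
  also have "f (k, b) * inverse (f (Suc k, b)) = ?V (k, b)"
    using k b_pos by (simp add: upslack_def up_def upsum_eq field_simps)
  also have "paths_from ?V (i, 1) n (k, b) * ?V (k, b) = ?V (i, 1) * paths_to ?V (k, b) n (i, 1)"
    using i k b_pos by (intro paths_from_to) auto
  finally show ?thesis
    using S S0 by simp
qed

end

section \<open>Reciprocity for birational evolutions\<close>

locale birational_evolution = rectangle +
  fixes L :: real and F :: "nat \<Rightarrow> nat \<times> nat \<Rightarrow> real"
  assumes L_pos: "L > 0"
    and F_pos: "v \<in> G \<Longrightarrow> F t v > 0"
    and F_step: "v \<in> G \<Longrightarrow> F (Suc t) v * F t v = down L (F (Suc t)) v * up (F t) v"
begin

text \<open>A rearrangement of \<open>F_step\<close>, and the only form in which the recurrence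
  enters the edge case.\<close>

lemma downslack_Suc: "v \<in> G \<Longrightarrow> downslack L (F (Suc t)) v = upslack (F t) v"
  using F_step[of v t] F_pos[of v t] F_pos[of v "Suc t"] up_pos[of v "F t", OF _ F_pos]
  by (simp add: downslack_def upslack_def divide_simps mult.commute)

text \<open>By \<open>upslack_paths\<close> and the exchange of slacks, \<open>F t (i, 1)\<close> is
  a path sum at time \<open>Suc t\<close> from \<open>(i, 1)\<close> to \<open>(a, b)\<close>. Each
  further time step moves both ends one column to the left by \<open>conversion\<close>; after
  \<open>i - 1\<close> of them the paths start at \<open>(1, 1)\<close>, where
  \<open>downslack_paths\<close> evaluates the sum.\<close>

lemma reciprocity_edge:
  assumes "1 \<le> i" "i \<le> a"
  shows "F t (i, 1) * F (t + i) (a + 1 - i, b) = L"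
proof -
  define n where "n = a + b - (i + 1)"
  define E where "E t i k = downslack L (F t) (i, 1) * paths_to (downslack L (F t)) (k, b) n (i, 1)"
    for t i k
  have shift: "upslack (F t) (i, 1) * paths_to (upslack (F t)) (k, b) n (i, 1) = E (Suc t) i k"
    if "1 \<le> i" "i \<le> a" for t i k
    unfolding E_def using that b_pos downslack_Suc paths_to_cong
    by (smt (verit, best) grid_iff le_refl)
  have chain: "E t (1 + j) (k + j) = E (t + j) 1 k" if "1 \<le> k" "k + j \<le> a" for t j k
    using that
  proof (induction j arbitrary: t)
    case (Suc j)
    have "E t (1 + Suc j) (k + Suc j) = E (Suc t) (1 + j) (k + j)"
      unfolding E_def using conversion[of "F t" "1 + j" "k + j" L n] F_pos Suc.prems
        shift[of "1 + j" t "k + j"] by (simp add: E_def)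
    also have "\<dots> = E (Suc t + j) 1 k"
      using Suc by simp
    finally show ?case
      by simp
  qed simp
  have "F t (i, 1) = E (Suc t) i a"
    using upslack_paths[of "F t" "(i, 1)" n] F_pos shift[of i t a] assms b_pos
    by (simp add: rk_def n_def)
  also have "\<dots> = E (Suc t + (i - 1)) 1 (a + 1 - i)"
    using chain[of "a + 1 - i" "i - 1" "Suc t"] assms by simp
  also have "Suc t + (i - 1) = t + i"
    using assms by simp
  also have "E (t + i) 1 (a + 1 - i)
      = paths_from (downslack L (F (t + i))) (1, 1) n (a + 1 - i, b) * downslack L (F (t + i)) (a + 1 - i, b)"
    unfolding E_def using assms a_pos b_pos by (subst paths_from_to) auto
  also have "\<dots> = L / F (t + i) (a + 1 - i, b)"
    using assms b_pos F_pos by (intro downslack_paths[symmetric]) (auto simp: rk_def n_def)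
  finally show ?thesis
    using F_pos[of "(a + 1 - i, b)" "t + i"] assms b_pos by fastforce
qed

theorem reciprocity:
  assumes "(x, y) \<in> G"
  shows "F t (x, y) * F (t + x + y - 1) (a + 1 - x, b + 1 - y) = L"
  using assms
proof (induction y arbitrary: x t rule: less_induct)
  case (less y)
  show ?case
  proof (cases "y = 1")
    case True
    then show ?thesis
      using reciprocity_edge[of x t] less.prems by simp
  next
    case False
    then obtain j where y: "y = Suc j" "1 \<le> j"
      using less.prems by (cases y) auto
    have IH: "F t (x, j') * F (t + x + j' - 1) (a + 1 - x, b + 1 - j') = L"
      if "1 \<le> j'" "j' \<le> j" "1 \<le> x" "x \<le> a" for j' x t
      using less.IH[of j' x t] that y less.prems by simp
    \<comment> \<open>The time at which the antipode of \<open>(x, j)\<close> answers to time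
      \<open>t\<close>; row \<open>y = Suc j\<close> needs \<open>Suc s\<close>.\<close>
    define s where "s = t + x + j - 1"
    define v where "v = (x, j)"
    define v' where "v' = (a + 1 - x, b + 1 - j)"
    have vG: "v \<in> G" "v' \<in> G"
      using less.prems y by (auto simp: v_def v'_def)
    have ne: "v \<noteq> (a, b)" "v' \<noteq> (1, 1)"
      using less.prems y by (auto simp: v_def v'_def)
    have r1: "F t v * F s v' = L" and r2: "F (Suc t) v * F (Suc s) v' = L"
      using IH[of j x t] IH[of j x "Suc t"] less.prems y by (auto simp: v_def v'_def s_def)
    \<comment> \<open>The upper neighbours of \<open>v'\<close> are the antipodes of the lower
      neighbours of \<open>v\<close>, which lie in rows up to \<open>j\<close>. The induction
      hypothesis pairs their values at time \<open>Suc t\<close> with time \<open>s\<close>.\<close>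
    have lower: "up (F s) v' * down L (F (Suc t)) v = L"
    proof (cases "v = (1, 1)")
      case True
      then show ?thesis
        by (auto simp: up_def down_def v_def v'_def)
    next
      case False
      have inv: "F s w' = L * inverse (F (Suc t) w)"
        if "F (Suc t) w * F s w' = L" "w \<in> G" for w w'
        using that F_pos[of w "Suc t"] by (simp add: field_simps)
      have "F s (Suc (a + 1 - x), b + 1 - j) = L * inverse (F (Suc t) (x - 1, j))" if "1 < x"
      proof -
        have "a + 1 - (x - 1) = Suc (a + 1 - x)" "Suc t + (x - 1) + j - 1 = s"
          using that less.prems y by (auto simp: s_def)
        then show ?thesis
          using IH[of j "x - 1" "Suc t"] that less.prems y by (intro inv) auto
      qed
      moreover have "F s (a + 1 - x, Suc (b + 1 - j)) = L * inverse (F (Suc t) (x, j - 1))" if "1 < j"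
      proof -
        have "b + 1 - (j - 1) = Suc (b + 1 - j)" "Suc t + x + (j - 1) - 1 = s"
          using that less.prems y by (auto simp: s_def)
        then show ?thesis
          using IH[of "j - 1" x "Suc t"] that less.prems y by (intro inv) auto
      qed
      moreover have "upsum (F s) v' = (if 1 < x then F s (Suc (a + 1 - x), b + 1 - j) else 0) +
          (if 1 < j then F s (a + 1 - x, Suc (b + 1 - j)) else 0)"
        using vG upsum_eq[of "a + 1 - x" "b + 1 - j" "F s"] less.prems y
        unfolding v'_def by auto
      ultimately have "upsum (F s) v' = L * downsum (\<lambda>w. inverse (F (Suc t) w)) v"
        using vG downsum_eq[of x j "\<lambda>w. inverse (F (Suc t) w)"]
        unfolding v_def by (simp add: distrib_left)
      moreover have "downsum (\<lambda>w. inverse (F (Suc t) w)) v > 0"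
        using downsum_pos[OF vG(1) False] F_pos by simp
      moreover have "v' \<noteq> (a, b)"
        using False less.prems y by (auto simp: v_def v'_def)
      ultimately show ?thesis
        using False by (simp add: up_def down_def)
    qed
    \<comment> \<open>Multiplying the recurrences at \<open>v\<close> and \<open>v'\<close> gives
      \<open>L * L\<close> on the left; \<open>lower\<close> evaluates half of the right-hand side,
      so the other half is \<open>L\<close> too.\<close>
    have "L * L = (F (Suc t) v * F t v) * (F (Suc s) v' * F s v')"
      using r1 r2 by (metis mult.assoc mult.commute)
    also have "\<dots> = (up (F s) v' * down L (F (Suc t)) v) * (up (F t) v * down L (F (Suc s)) v')"
      by (simp add: F_step vG)
    finally have "up (F t) v * down L (F (Suc s)) v' = L"
      using lower L_pos by simp
    then have *: "upsum (F t) v = L * downsum (\<lambda>w. inverse (F (Suc s) w)) v'"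
      using ne downsum_pos[OF vG(2) ne(2), of "\<lambda>w. inverse (F (Suc s) w)"] F_pos
      by (simp add: up_def down_def field_simps)
    \<comment> \<open>The horizontal neighbour lies in row \<open>j\<close>, so the induction
      hypothesis settles its term; subtracting it from the equation just obtained isolates the
      vertical neighbour \<open>(x, Suc j)\<close>.\<close>
    have right: "F t (Suc x, j) = L * inverse (F (Suc s) (a - x, b + 1 - j))" if "x < a"
    proof -
      have "F (Suc s) (a - x, b + 1 - j) > 0"
        using that less.prems y by (intro F_pos) auto
      moreover have "F t (Suc x, j) * F (Suc s) (a - x, b + 1 - j) = L"
        using IH[of j "Suc x" t] that less.prems y by (simp add: s_def add_ac)
      ultimately show ?thesis
        by (simp add: field_simps)
    qed
    have "upsum (F t) v = (if x < a then F t (Suc x, j) else 0) + F t (x, Suc j)"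
      using upsum_eq[of x j "F t"] vG less.prems y unfolding v_def by simp
    moreover have "downsum (\<lambda>w. inverse (F (Suc s) w)) v' =
        (if x < a then inverse (F (Suc s) (a - x, b + 1 - j)) else 0) +
        inverse (F (Suc s) (a + 1 - x, b - j))"
      using downsum_eq[of "a + 1 - x" "b + 1 - j" "\<lambda>w. inverse (F (Suc s) w)"] vG less.prems y
      unfolding v'_def by auto
    ultimately have "F t (x, Suc j) = L * inverse (F (Suc s) (a + 1 - x, b - j))"
      using * right by (auto simp: distrib_left split: if_splits)
    moreover have "F (Suc s) (a + 1 - x, b - j) > 0"
      using less.prems y by (intro F_pos) auto
    moreover have "Suc s = t + x + y - 1" "b - j = b + 1 - y" "Suc j = y"
      using less.prems y by (auto simp: s_def)
    ultimately show ?thesis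
      by simp
  qed
qed

end

subsection \<open>The tropical limit\<close>

text \<open>\<open>F N\<close> has size \<open>exp (N * x)\<close> up to subexponential factors.
  Positivity at every \<open>N\<close> keeps quotients and logarithms free of side
  conditions.\<close>

definition tropicalizes :: "(real \<Rightarrow> real) \<Rightarrow> real \<Rightarrow> bool" where
  "tropicalizes F x \<longleftrightarrow> (\<forall>N. F N > 0) \<and> ((\<lambda>N. ln (F N) / N) \<longlongrightarrow> x) at_top"

lemma tropicalizes_1: "tropicalizes (\<lambda>N. 1) 0"
  by (simp add: tropicalizes_def)

lemma tropicalizes_exp: "tropicalizes (\<lambda>N. exp (N * x)) x"
proof -
  have "\<forall>\<^sub>F N in at_top. ln (exp (N * x)) / N = x"
    using eventually_gt_at_top[of "0::real"] by eventually_elim simp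
  then show ?thesis
    by (simp add: tropicalizes_def tendsto_eventually)
qed

lemma tropicalizes_mult:
  assumes "tropicalizes F x" "tropicalizes H y"
  shows "tropicalizes (\<lambda>N. F N * H N) (x + y)"
  using assms tendsto_add[of "\<lambda>N. ln (F N) / N" x at_top "\<lambda>N. ln (H N) / N" y]
  by (auto simp: tropicalizes_def ln_mult_pos add_divide_distrib)

lemma tropicalizes_inverse:
  assumes "tropicalizes F x"
  shows "tropicalizes (\<lambda>N. inverse (F N)) (- x)"
  using assms tendsto_minus[of "\<lambda>N. ln (F N) / N" x at_top]
  by (auto simp: tropicalizes_def ln_inverse)

lemma tropicalizes_divide:
  assumes "tropicalizes F x" "tropicalizes H y"
  shows "tropicalizes (\<lambda>N. F N / H N) (x - y)"
  using tropicalizes_mult[OF assms(1) tropicalizes_inverse[OF assms(2)]]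
  by (simp add: divide_inverse)

text \<open>The sum lies between the maximum of the summands and twice that maximum; the error
  \<open>ln 2\<close> vanishes after division by \<open>N\<close>.\<close>

lemma tropicalizes_add:
  assumes "tropicalizes F x" "tropicalizes H y"
  shows "tropicalizes (\<lambda>N. F N + H N) (max x y)"
  unfolding tropicalizes_def
proof (intro conjI allI)
  have pos: "F N > 0" "H N > 0" for N
    using assms by (auto simp: tropicalizes_def)
  then show "F N + H N > 0" for N
    by (simp add: add_pos_pos)
  let ?m = "\<lambda>N. max (ln (F N) / N) (ln (H N) / N)"
  have m: "(?m \<longlongrightarrow> max x y) at_top"
    using assms by (intro tendsto_max) (auto simp: tropicalizes_def)
  have "((\<lambda>N::real. ln 2 / N) \<longlongrightarrow> 0) at_top"
    by (intro tendsto_divide_0[OF tendsto_const]) (simp add: filterlim_at_top_imp_at_infinity filterlim_ident)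
  from tendsto_add[OF m this] have m': "((\<lambda>N. ?m N + ln 2 / N) \<longlongrightarrow> max x y) at_top"
    by simp
  show "((\<lambda>N. ln (F N + H N) / N) \<longlongrightarrow> max x y) at_top"
  proof (rule tendsto_sandwich[OF _ _ m m'])
    show "\<forall>\<^sub>F N in at_top. ?m N \<le> ln (F N + H N) / N"
      using eventually_gt_at_top[of "0::real"]
    proof eventually_elim
      case (elim N)
      then show ?case
        using pos[of N] by (auto intro!: divide_right_mono)
    qed
    show "\<forall>\<^sub>F N in at_top. ln (F N + H N) / N \<le> ?m N + ln 2 / N"
      using eventually_gt_at_top[of "0::real"]
    proof eventually_elim
      case (elim N)
      have "ln (F N + H N) \<le> ln (2 * max (F N) (H N))"
        using pos[of N] by (subst ln_le_cancel_iff) auto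
      also have "\<dots> = ln 2 + max (ln (F N)) (ln (H N))"
        using pos[of N] by (auto simp: ln_mult_pos max_def)
      finally have "ln (F N + H N) / N \<le> (ln 2 + max (ln (F N)) (ln (H N))) / N"
        using elim by (simp add: divide_right_mono)
      also have "\<dots> = ?m N + ln 2 / N"
        using elim by (auto simp: max_def add_divide_distrib divide_le_cancel)
      finally show ?case .
    qed
  qed
qed

lemma tropicalizes_unique:
  assumes "tropicalizes F x" "tropicalizes F y"
  shows "x = y"
  using assms by (auto simp: tropicalizes_def intro: tendsto_unique[OF trivial_limit_at_top_linorder])

section \<open>Evolutions with prescribed initial values\<close>

context rectangle
begin

text \<open>The recurrence solved for the new value. The recursion descends in time and, within one
  time step, towards \<open>(1, 1)\<close>.\<close>

fun evolve :: "real \<Rightarrow> (nat \<times> nat \<Rightarrow> real) \<Rightarrow> nat \<Rightarrow> nat \<Rightarrow> nat \<Rightarrow> real" where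
  "evolve L f 0 x y = f (x, y)"
| "evolve L f (Suc t) x y =
     (if (x, y) = (1, 1) then L
      else inverse ((if 1 < x then inverse (evolve L f (Suc t) (x - 1) y) else 0) +
                    (if 1 < y then inverse (evolve L f (Suc t) x (y - 1)) else 0))) *
     (if (x, y) = (a, b) then 1
      else (if x < a then evolve L f t (Suc x) y else 0) +
           (if y < b then evolve L f t x (Suc y) else 0)) / evolve L f t x y"

declare evolve.simps(2) [simp del]

lemma evolve_pos:
  assumes "L > 0" "\<And>v. v \<in> G \<Longrightarrow> f v > 0" "(x, y) \<in> G"
  shows "evolve L f t x y > 0"
  using assms(3)
proof (induction t arbitrary: x y)
  case 0
  then show ?case
    using assms by simp
next
  case (Suc t x y)
  note IH = Suc.IH
  from Suc.prems show ?case
  proof (induction "x + y" arbitrary: x y rule: less_induct)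
    case less
    have "evolve L f (Suc t) (x - 1) y > 0" if "1 < x"
      using less.prems that by (intro less.hyps) auto
    moreover have "evolve L f (Suc t) x (y - 1) > 0" if "1 < y"
      using less.prems that by (intro less.hyps) auto
    moreover have "evolve L f t (Suc x) y > 0" if "x < a"
      using less.prems that by (intro IH) auto
    moreover have "evolve L f t x (Suc y) > 0" if "y < b"
      using less.prems that by (intro IH) auto
    moreover have "evolve L f t x y > 0"
      using less.prems by (intro IH) auto
    moreover have "x = 1 \<or> 1 < x" "y = 1 \<or> 1 < y" "x = a \<or> x < a" "y = b \<or> y < b"
      using less.prems by auto
    ultimately show ?case
      using assms(1) by (subst evolve.simps(2)) (auto intro!: mult_pos_pos divide_pos_pos add_pos_pos)
  qed
qed

lemma evolve_birational:
  assumes "L > 0" "\<And>v. v \<in> G \<Longrightarrow> f v > 0"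
  shows "birational_evolution a b L (\<lambda>t (x, y). evolve L f t x y)"
proof
  show "L > 0"
    by fact
  show "(case v of (x, y) \<Rightarrow> evolve L f t x y) > 0" if "v \<in> G" for v t
    using evolve_pos assms that by (cases v) auto
  show "(case v of (x, y) \<Rightarrow> evolve L f (Suc t) x y) * (case v of (x, y) \<Rightarrow> evolve L f t x y) =
      down L (\<lambda>(x, y). evolve L f (Suc t) x y) v * up (\<lambda>(x, y). evolve L f t x y) v"
    if "v \<in> G" for v t
  proof (cases v)
    case (Pair x y)
    then show ?thesis
      using evolve_pos[of L f x y t] assms that
      by (simp add: down_def up_def upsum_eq downsum_eq evolve.simps(2)[of L f t x y])
  qed
qed

text \<open>Positions outside the rectangle count as 0 above and as \<open>l\<close> below. The
  birational sums lack these terms; both versions agree in the limit because all entries lie between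
  0 and \<open>l\<close>. The type is general since natural and real entries both occur.\<close>

definition upmax :: "(nat \<times> nat \<Rightarrow> 'a::{linorder,zero}) \<Rightarrow> nat \<times> nat \<Rightarrow> 'a" where
  "upmax f = (\<lambda>(x, y). max (if x < a then f (Suc x, y) else 0) (if y < b then f (x, Suc y) else 0))"

definition downmin :: "'a \<Rightarrow> (nat \<times> nat \<Rightarrow> 'a::linorder) \<Rightarrow> nat \<times> nat \<Rightarrow> 'a" where
  "downmin l f = (\<lambda>(x, y). min (if 1 < x then f (x - 1, y) else l) (if 1 < y then f (x, y - 1) else l))"

end

section \<open>Piecewise-linear evolutions as limits of birational ones\<close>

locale tropical_evolution = rectangle +
  fixes l :: real and c :: "nat \<Rightarrow> nat \<times> nat \<Rightarrow> real"
  assumes c_bounds: "v \<in> G \<Longrightarrow> 0 \<le> c t v \<and> c t v \<le> l"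
    and c_step: "v \<in> G \<Longrightarrow> c (Suc t) v + c t v = downmin l (c (Suc t)) v + upmax (c t) v"
begin

definition lift :: "nat \<Rightarrow> nat \<Rightarrow> nat \<Rightarrow> real \<Rightarrow> real" where
  "lift t x y = (\<lambda>N. evolve (exp (N * l)) (\<lambda>v. exp (N * c 0 v)) t x y)"

text \<open>Induction on time and, within a step, on the antidiagonal: the lift obeys the same
  recurrence as \<open>c\<close>, and each birational operation tropicalizes to its piecewise-linear
  counterpart.\<close>

lemma tropicalizes_lift: "(x, y) \<in> G \<Longrightarrow> tropicalizes (lift t x y) (c t (x, y))"
proof (induction t arbitrary: x y)
  case 0
  then show ?case
    by (simp add: lift_def tropicalizes_exp)
next
  case (Suc t x y)
  note IH = Suc.IH
  have "tropicalizes (lift (Suc t) x y) (c (Suc t) (x, y))" if "(x, y) \<in> G"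
    using that
  proof (induction "x + y" arbitrary: x y rule: less_induct)
    case less
    \<comment> \<open>\<open>D\<close> is the factor from below at the new time, \<open>U\<close>
      the factor from above at the old time.\<close>
    define D where "D = (\<lambda>N. if (x, y) = (1, 1) then exp (N * l)
      else inverse ((if 1 < x then inverse (lift (Suc t) (x - 1) y N) else 0) +
                    (if 1 < y then inverse (lift (Suc t) x (y - 1) N) else 0)))"
    define U where "U = (\<lambda>N. if (x, y) = (a, b) then 1
      else (if x < a then lift t (Suc x) y N else 0) + (if y < b then lift t x (Suc y) N else 0))"
    have left: "tropicalizes (lift (Suc t) (x - 1) y) (c (Suc t) (x - 1, y))"
      and left_le: "c (Suc t) (x - 1, y) \<le> l" if "1 < x"
    proof -
      have "(x - 1, y) \<in> G"
        using less.prems that by auto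
      then show "tropicalizes (lift (Suc t) (x - 1) y) (c (Suc t) (x - 1, y))" "c (Suc t) (x - 1, y) \<le> l"
        using less.hyps[of "x - 1" y] less.prems c_bounds[of "(x - 1, y)" "Suc t"] that by fastforce+
    qed
    have below: "tropicalizes (lift (Suc t) x (y - 1)) (c (Suc t) (x, y - 1))"
      and below_le: "c (Suc t) (x, y - 1) \<le> l" if "1 < y"
    proof -
      have "(x, y - 1) \<in> G"
        using less.prems that by auto
      then show "tropicalizes (lift (Suc t) x (y - 1)) (c (Suc t) (x, y - 1))" "c (Suc t) (x, y - 1) \<le> l"
        using less.hyps[of x "y - 1"] less.prems c_bounds[of "(x, y - 1)" "Suc t"] that by fastforce+
    qed
    consider "x = 1" "y = 1" | "1 < x" "y = 1" | "x = 1" "1 < y" | "1 < x" "1 < y"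
      using less.prems by fastforce
    then have D: "tropicalizes D (downmin l (c (Suc t)) (x, y))"
    proof cases
      case 1
      then show ?thesis
        by (simp add: D_def downmin_def tropicalizes_exp)
    next
      case 2
      then show ?thesis
        using left left_le by (simp add: D_def downmin_def min_absorb1)
    next
      case 3
      then show ?thesis
        using below below_le by (simp add: D_def downmin_def min_absorb2)
    next
      case 4
      then show ?thesis
        using tropicalizes_inverse[OF tropicalizes_add[OF tropicalizes_inverse[OF left]
          tropicalizes_inverse[OF below]]] by (simp add: D_def downmin_def minus_max_eq_min)
    qed
    have right: "tropicalizes (lift t (Suc x) y) (c t (Suc x, y))"
      and right_ge: "0 \<le> c t (Suc x, y)" if "x < a"
      using IH[of "Suc x" y] c_bounds[of "(Suc x, y)" t] less.prems that by auto
    have above: "tropicalizes (lift t x (Suc y)) (c t (x, Suc y))"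
      and above_ge: "0 \<le> c t (x, Suc y)" if "y < b"
      using IH[of x "Suc y"] c_bounds[of "(x, Suc y)" t] less.prems that by auto
    consider "x = a" "y = b" | "x < a" "y = b" | "x = a" "y < b" | "x < a" "y < b"
      using less.prems by fastforce
    then have U: "tropicalizes U (upmax (c t) (x, y))"
    proof cases
      case 1
      then show ?thesis
        by (simp add: U_def upmax_def tropicalizes_1)
    next
      case 2
      then show ?thesis
        using right right_ge by (simp add: U_def upmax_def max_absorb1)
    next
      case 3
      then show ?thesis
        using above above_ge by (simp add: U_def upmax_def max_absorb2)
    next
      case 4
      then show ?thesis
        using tropicalizes_add[OF right above] by (simp add: U_def upmax_def)
    qed
    have "lift (Suc t) x y = (\<lambda>N. D N * U N / lift t x y N)"
      unfolding lift_def D_def U_def by (subst evolve.simps(2)) (rule refl)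
    with tropicalizes_divide[OF tropicalizes_mult[OF D U] IH[OF less.prems]]
    have "tropicalizes (lift (Suc t) x y) (downmin l (c (Suc t)) (x, y) + upmax (c t) (x, y) - c t (x, y))"
      by (simp only:)
    moreover have "downmin l (c (Suc t)) (x, y) + upmax (c t) (x, y) - c t (x, y) = c (Suc t) (x, y)"
      using c_step[OF less.prems, of t] by linarith
    ultimately show ?case
      by (simp only:)
  qed
  with Suc.prems show ?case
    by simp
qed

text \<open>For every \<open>N\<close> birational reciprocity makes the product of the two lifts
  exactly \<open>exp (N * l)\<close>; uniqueness of the exponent gives the claim.\<close>

theorem tropical_reciprocity:
  assumes "(x, y) \<in> G"
  shows "c t (x, y) + c (t + x + y - 1) (a + 1 - x, b + 1 - y) = l"
proof -
  have "(a + 1 - x, b + 1 - y) \<in> G"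
    using assms by auto
  then have "tropicalizes (\<lambda>N. lift t x y N * lift (t + x + y - 1) (a + 1 - x) (b + 1 - y) N)
      (c t (x, y) + c (t + x + y - 1) (a + 1 - x, b + 1 - y))"
    by (intro tropicalizes_mult tropicalizes_lift assms)
  moreover have "lift t x y N * lift (t + x + y - 1) (a + 1 - x) (b + 1 - y) N = exp (N * l)" for N
  proof -
    interpret birational_evolution a b "exp (N * l)"
      "\<lambda>t (x, y). evolve (exp (N * l)) (\<lambda>v. exp (N * c 0 v)) t x y"
      by (rule evolve_birational) auto
    show ?thesis
      using reciprocity[OF assms, of t] by (simp add: lift_def)
  qed
  ultimately have "tropicalizes (\<lambda>N. exp (N * l))
      (c t (x, y) + c (t + x + y - 1) (a + 1 - x, b + 1 - y))"
    by (simp only:)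
  then show ?thesis
    by (rule tropicalizes_unique[OF _ tropicalizes_exp])
qed

end

subsection \<open>Promotion of labelings\<close>

text \<open>Over a full period, each unit shift drops the first value and gains the equal value one
  period later.\<close>

lemma image_mset_shift:
  fixes h :: "nat \<Rightarrow> 'a"
  assumes "\<And>t. h (t + n) = h t"
  shows "image_mset (\<lambda>t. h (t + s)) (mset_set {0..<n}) = image_mset h (mset_set {0..<n})"
proof (induction s)
  case (Suc s)
  let ?g = "\<lambda>t. h (t + s)"
  have "image_mset (\<lambda>t. h (t + Suc s)) (mset_set {0..<n}) = image_mset ?g (image_mset Suc (mset_set {0..<n}))"
    by (simp add: image_mset.compositionality comp_def)
  also have "image_mset Suc (mset_set {0..<n}) = mset_set {Suc 0..<Suc n}"
    by (simp add: image_mset_mset_set)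
  also have "image_mset ?g (mset_set {Suc 0..<Suc n}) = image_mset ?g (mset_set {0..<n})"
  proof (cases n)
    case (Suc m)
    have "{Suc 0..<Suc n} = insert n {Suc 0..<n}" "{0..<n} = insert 0 {Suc 0..<n}"
      using Suc by auto
    then have "image_mset ?g (mset_set {Suc 0..<Suc n}) = add_mset (?g n) (image_mset ?g (mset_set {Suc 0..<n}))"
      "image_mset ?g (mset_set {0..<n}) = add_mset (?g 0) (image_mset ?g (mset_set {Suc 0..<n}))"
      by simp_all
    moreover have "?g n = ?g 0"
      using assms[of s] by (simp add: add.commute)
    ultimately show ?thesis
      by simp
  qed simp
  finally show ?case
    using Suc by simp
qed simp

section \<open>Strict labelings as plane partitions\<close>

context rectangle
begin

lemma grid_cov_less: "cov v w \<Longrightarrow> v < w"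
  by (cases v; cases w) (auto simp: cov_def less_prod_def)

text \<open>Points two or more ranks apart have disjoint, ordered sets of allowed labels, so this
  split leaves strictness to be checked on covers only.\<close>

lemma less_cases: "v < w \<Longrightarrow> cov v w \<or> rk v + 2 \<le> rk w"
  by (cases v; cases w) (auto simp: cov_def rk_def less_prod_def)

lemma rk_less: "v < w \<Longrightarrow> rk v < rk (w :: nat \<times> nat)"
  by (cases v; cases w) (auto simp: rk_def less_prod_def)

text \<open>A chain from \<open>(1, 1)\<close> forces \<open>g v\<close> to be at least
  \<open>rk v - 1\<close>, and a chain to \<open>(a, b)\<close> forces it to be at most
  \<open>rk v\<close>. The functions \<open>rk - 1\<close> and \<open>rk\<close> attain the two
  values.\<close>

lemma grid_restriction_eq:
  assumes "v \<in> G"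
  shows "grid_restriction a b v = {int (rk v) - 1, int (rk v)}"
proof (intro equalityI subsetI)
  fix k assume "k \<in> grid_restriction a b v"
  then obtain g where g: "g \<in> G \<rightarrow> {1..int (a + b)}" and k: "g v = k"
    and mono: "\<And>p q. p \<in> G \<Longrightarrow> q \<in> G \<Longrightarrow> p < q \<Longrightarrow> g p < g q"
    unfolding grid_restriction_def bounded_restriction_def by blast
  have lower: "int (x + y) - 1 \<le> g (x, y)" if "(x, y) \<in> G" for x y
    using that
  proof (induction "x + y" arbitrary: x y rule: less_induct)
    case less
    consider "x = 1" "y = 1" | "1 < x" | "1 < y"
      using less.prems by fastforce
    then show ?case
    proof cases
      case 1
      then show ?thesis
        using g less.prems by auto
    next
      case 2
      then have p: "(x - 1, y) \<in> G" "(x - 1, y) < (x, y)"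
        using less.prems by (auto simp: less_prod_def)
      then show ?thesis
        using less.hyps[of "x - 1" y] mono[OF p(1) less.prems p(2)] 2 by force
    next
      case 3
      then have p: "(x, y - 1) \<in> G" "(x, y - 1) < (x, y)"
        using less.prems by (auto simp: less_prod_def)
      then show ?thesis
        using less.hyps[of x "y - 1"] mono[OF p(1) less.prems p(2)] 3 by force
    qed
  qed
  have upper: "g (x, y) \<le> int (x + y)" if "(x, y) \<in> G" for x y
    using that
  proof (induction "a + b - (x + y)" arbitrary: x y rule: less_induct)
    case less
    consider "x = a" "y = b" | "x < a" | "y < b"
      using less.prems by fastforce
    then show ?case
    proof cases
      case 1
      then show ?thesis
        using g less.prems by auto
    next
      case 2
      then have p: "(Suc x, y) \<in> G" "(x, y) < (Suc x, y)"
        using less.prems by (auto simp: less_prod_def)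
      then show ?thesis
        using less.hyps[of "Suc x" y] mono[OF less.prems p] 2 by force
    next
      case 3
      then have p: "(x, Suc y) \<in> G" "(x, y) < (x, Suc y)"
        using less.prems by (auto simp: less_prod_def)
      then show ?thesis
        using less.hyps[of x "Suc y"] mono[OF less.prems p] 3 by force
    qed
  qed
  show "k \<in> {int (rk v) - 1, int (rk v)}"
    using lower[of "fst v" "snd v"] upper[of "fst v" "snd v"] assms k by (auto simp: rk_def)
next
  fix k assume "k \<in> {int (rk v) - 1, int (rk v)}"
  then obtain e where e: "e = 0 \<or> e = 1" "k = int (rk v) - e"
    by force
  have "(\<lambda>v. int (rk v) - e) \<in> G \<rightarrow> {1..int (a + b)}"
    using e(1) by (auto simp: rk_def grid_def)
  then show "k \<in> grid_restriction a b v"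
    unfolding grid_restriction_def bounded_restriction_def e(2) using rk_less
    by (intro CollectI exI[of _ "\<lambda>v. int (rk v) - e"]) simp
qed

definition labeling :: "nat \<Rightarrow> (nat \<times> nat \<Rightarrow> nat) \<Rightarrow> (nat \<times> nat) \<times> nat \<Rightarrow> int" where
  "labeling l c = (\<lambda>(v, i). if v \<in> G \<and> i \<in> {1..l}
     then if i \<le> c v then int (rk v) - 1 else int (rk v) else undefined)"

definition partition_on_grid :: "nat \<Rightarrow> (nat \<times> nat \<Rightarrow> nat) \<Rightarrow> bool" where
  "partition_on_grid l c \<longleftrightarrow> (\<forall>v\<in>G. c v \<le> l) \<and> (\<forall>v\<in>G. \<forall>w\<in>G. cov v w \<longrightarrow> c w \<le> c v)"

abbreviation "R \<equiv> grid_restriction a b"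

text \<open>On a cover \<open>v < w\<close> the larger label of \<open>v\<close> equals the smaller
  label of \<open>w\<close>; this clash at position \<open>i\<close> would need
  \<open>c v < i\<close> and \<open>i \<le> c w\<close>.\<close>

lemma labeling_strict:
  assumes "partition_on_grid l c"
  shows "labeling l c \<in> strict_labelings G l R"
proof -
  have "labeling l c \<in> PiE (G \<times> {1..l}) (\<lambda>(p, i). R p)"
    by (auto simp: labeling_def grid_restriction_eq split: if_splits)
  moreover have "labeling l c (v, i) < labeling l c (w, i)"
    if vw: "v \<in> G" "w \<in> G" "i \<in> {1..l}" "v < w" for v w i
  proof (cases "cov v w")
    case True
    then have "c w \<le> c v" "rk w = Suc (rk v)"
      using assms vw cov_rk by (auto simp: partition_on_grid_def)
    then show ?thesis
      using vw by (auto simp: labeling_def)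
  next
    case False
    then show ?thesis
      using vw less_cases[OF vw(4)] by (auto simp: labeling_def)
  qed
  moreover have "labeling l c (v, i) \<le> labeling l c (v, j)"
    if "v \<in> G" "i \<in> {1..l}" "j \<in> {1..l}" "i \<le> j" for v i j
    using that by (auto simp: labeling_def)
  ultimately show ?thesis
    unfolding strict_labelings_def by blast
qed

lemma strict_labelingE:
  assumes "f \<in> strict_labelings G l R"
  obtains c where "partition_on_grid l c" "f = labeling l c"
proof -
  have PiE: "f \<in> PiE (G \<times> {1..l}) (\<lambda>(v, i). R v)"
    using assms by (simp add: strict_labelings_def)
  then have ext: "f \<in> extensional (G \<times> {1..l})"
    by (simp add: PiE_def)
  have val: "f (v, i) = int (rk v) - 1 \<or> f (v, i) = int (rk v)" if "v \<in> G" "i \<in> {1..l}" for v i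
    using PiE_mem[OF PiE, of "(v, i)"] that grid_restriction_eq[of v] by simp
  have strict: "f (v, i) < f (w, i)" if "v \<in> G" "w \<in> G" "i \<in> {1..l}" "v < w" for v w i
    using assms that by (auto simp: strict_labelings_def)
  have mono: "f (v, i) \<le> f (v, j)" if "v \<in> G" "i \<in> {1..l}" "j \<in> {1..l}" "i \<le> j" for v i j
    using assms that by (auto simp: strict_labelings_def)
  define S where "S v = {i \<in> {1..l}. f (v, i) < int (rk v)}" for v
  \<comment> \<open>The inserted 0 serves the fibers without a smaller label.\<close>
  define c where "c v = Max (insert 0 (S v))" for v
  have c_in: "c v = 0 \<or> c v \<in> S v" for v
    using Max_in[of "insert 0 (S v)"] by (auto simp: c_def S_def)
  have le_c: "i \<le> c v \<longleftrightarrow> f (v, i) < int (rk v)" if "v \<in> G" "i \<in> {1..l}" for v i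
  proof
    assume "i \<le> c v"
    then have "c v \<in> S v"
      using c_in[of v] that by auto
    then show "f (v, i) < int (rk v)"
      using mono[of v i "c v"] that \<open>i \<le> c v\<close> by (auto simp: S_def)
  next
    assume "f (v, i) < int (rk v)"
    then show "i \<le> c v"
      unfolding c_def using that by (intro Max_ge) (auto simp: S_def)
  qed
  have "partition_on_grid l c"
    unfolding partition_on_grid_def
  proof (intro conjI ballI impI)
    show "c v \<le> l" for v
      using c_in[of v] by (auto simp: S_def)
    show "c w \<le> c v" if "v \<in> G" "w \<in> G" "cov v w" for v w
    proof (cases "c w = 0")
      case False
      \<comment> \<open>At position \<open>c w\<close> the point \<open>w\<close> carries its
        smaller label, which forces the smaller label at \<open>v\<close> there.\<close>
      then have "c w \<in> {1..l}" "f (w, c w) < int (rk w)"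
        using c_in[of w] by (auto simp: S_def)
      then show ?thesis
        using le_c[of v "c w"] strict[of v w "c w"] grid_cov_less[OF that(3)] cov_rk[OF that(3)] that
        by auto
    qed simp
  qed
  moreover have "f = labeling l c"
  proof
    fix p :: "(nat \<times> nat) \<times> nat"
    obtain v i where "p = (v, i)"
      by (cases p)
    then show "f p = labeling l c p"
      using le_c[of v i] val[of v i] extensional_arb[OF ext, of "(v, i)"] by (auto simp: labeling_def)
  qed
  ultimately show ?thesis
    by (rule that)
qed

section \<open>Admissible values of a single entry\<close>

lemma upmax_le_iff:
  fixes c :: "nat \<times> nat \<Rightarrow> nat"
  assumes "v \<in> G"
  shows "upmax c v \<le> m \<longleftrightarrow> (\<forall>w\<in>G. cov v w \<longrightarrow> c w \<le> m)"
proof (cases v)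
  case (Pair x y)
  show ?thesis
    using assms by (auto simp: Pair upmax_def cov_def)
qed

lemma le_downmin_iff:
  fixes c :: "nat \<times> nat \<Rightarrow> nat"
  assumes "v \<in> G" and le: "\<forall>w\<in>G. c w \<le> l"
  shows "m \<le> downmin l c v \<longleftrightarrow> m \<le> l \<and> (\<forall>w\<in>G. cov w v \<longrightarrow> m \<le> c w)"
proof (cases v)
  case (Pair x y)
  have left: "(x - 1, y) \<in> G \<and> cov (x - 1, y) v" if "1 < x"
    using that assms by (auto simp: Pair cov_def)
  have below: "(x, y - 1) \<in> G \<and> cov (x, y - 1) v" if "1 < y"
    using that assms by (auto simp: Pair cov_def)
  have "m \<le> l" if "m \<le> downmin l c v"
    using that le[rule_format, of "(x - 1, y)"] le[rule_format, of "(x, y - 1)"] left below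
    by (auto simp: Pair downmin_def split: if_splits)
  moreover have "m \<le> c w" if "m \<le> downmin l c v" "w \<in> G" "cov w v" for w
    using that by (cases w) (auto simp: Pair downmin_def cov_def)
  moreover have "m \<le> downmin l c v" if "m \<le> l" "\<forall>w\<in>G. cov w v \<longrightarrow> m \<le> c w"
    using that left below by (auto simp: Pair downmin_def)
  ultimately show ?thesis
    by blast
qed

lemma upmax_cong: "(\<And>w. cov v w \<Longrightarrow> f w = g w) \<Longrightarrow> upmax f v = upmax g v"
  by (cases v) (auto simp: upmax_def cov_def)

lemma downmin_cong: "(\<And>w. cov w v \<Longrightarrow> f w = g w) \<Longrightarrow> downmin l f v = downmin l g v"
  by (cases v) (auto simp: downmin_def cov_def)

lemma partition_bounds:
  assumes "partition_on_grid l c" "v \<in> G"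
  shows "upmax c v \<le> c v" "c v \<le> downmin l c v" "downmin l c v \<le> l"
proof -
  have le: "\<forall>w\<in>G. c w \<le> l"
    using assms by (simp add: partition_on_grid_def)
  show "upmax c v \<le> c v"
    using assms upmax_le_iff by (auto simp: partition_on_grid_def)
  show "c v \<le> downmin l c v"
    using assms le_downmin_iff[OF _ le] by (auto simp: partition_on_grid_def)
  show "downmin l c v \<le> l"
    using le_downmin_iff[OF assms(2) le] by blast
qed

text \<open>The only conditions on one entry come from its neighbours and the bound
  \<open>l\<close>, so it moves freely within an interval, from which the free labels are read
  off.\<close>

lemma partition_update_iff:
  assumes c: "partition_on_grid l c" and v: "v \<in> G"
  shows "(\<exists>c'. partition_on_grid l c' \<and> c' v = m \<and> (\<forall>w\<in>G. w \<noteq> v \<longrightarrow> c' w = c w)) \<longleftrightarrow>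
    upmax c v \<le> m \<and> m \<le> downmin l c v"
proof
  have le: "\<forall>w\<in>G. c w \<le> l"
    using c by (simp add: partition_on_grid_def)
  have ne: "\<not> cov w w" for w
    using cov_rk[of w w] by auto
  show "upmax c v \<le> m \<and> m \<le> downmin l c v"
    if ex: "\<exists>c'. partition_on_grid l c' \<and> c' v = m \<and> (\<forall>w\<in>G. w \<noteq> v \<longrightarrow> c' w = c w)"
  proof -
    obtain c' where c': "partition_on_grid l c'" "c' v = m" "\<forall>w\<in>G. w \<noteq> v \<longrightarrow> c' w = c w"
      using ex by blast
    have "m \<le> l" "\<And>w. w \<in> G \<Longrightarrow> cov v w \<Longrightarrow> c w \<le> m" "\<And>w. w \<in> G \<Longrightarrow> cov w v \<Longrightarrow> m \<le> c w"
      using c' v ne unfolding partition_on_grid_def by metis+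
    then show ?thesis
      unfolding upmax_le_iff[OF v] le_downmin_iff[OF v le] by blast
  qed
  assume "upmax c v \<le> m \<and> m \<le> downmin l c v"
  then have "partition_on_grid l (c(v := m))"
    unfolding upmax_le_iff[OF v] le_downmin_iff[OF v le]
    using c by (auto simp: partition_on_grid_def)
  then show "\<exists>c'. partition_on_grid l c' \<and> c' v = m \<and> (\<forall>w\<in>G. w \<noteq> v \<longrightarrow> c' w = c w)"
    by (intro exI[of _ "c(v := m)"]) auto
qed

lemma labeling_eq_iff:
  assumes "partition_on_grid l c" "partition_on_grid l c'" "v \<in> G"
  shows "(\<forall>i\<in>{1..l}. labeling l c (v, i) = labeling l c' (v, i)) \<longleftrightarrow> c v = c' v"
proof
  assume *: "\<forall>i\<in>{1..l}. labeling l c (v, i) = labeling l c' (v, i)"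
  have "i \<le> c v \<longleftrightarrow> i \<le> c' v" if "i \<in> {1..l}" for i
    using *[rule_format, OF that] assms that by (auto simp: labeling_def split: if_splits)
  moreover have "c v \<le> l" "c' v \<le> l"
    using assms by (auto simp: partition_on_grid_def)
  ultimately show "c v = c' v"
    by (metis atLeastAtMost_iff le_antisym le_zero_eq nat_le_linear not_less_eq_eq One_nat_def)
qed (simp add: labeling_def)

text \<open>Shared by \<open>raisable\<close> and \<open>lowerable\<close>, with \<open>P\<close> as
  either comparison. Changing one fiber amounts to a new entry \<open>m\<close> at \<open>v\<close>;
  a constant function suffices on the right because only a label over \<open>v\<close> is
  read.\<close>

lemma ex_labeling_iff:
  assumes c: "partition_on_grid l c" and v: "v \<in> G"
  shows "(\<exists>g\<in>strict_labelings G l R. P (g (v, i)) \<and>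
      (\<forall>w\<in>G. \<forall>j\<in>{1..l}. w \<noteq> v \<longrightarrow> labeling l c (w, j) = g (w, j))) \<longleftrightarrow>
    (\<exists>m. upmax c v \<le> m \<and> m \<le> downmin l c v \<and> P (labeling l (\<lambda>_. m) (v, i)))"
  (is "?lhs \<longleftrightarrow> ?rhs")
proof
  assume ?lhs
  then obtain g where g: "g \<in> strict_labelings G l R" and P: "P (g (v, i))"
    and eq: "\<forall>w\<in>G. \<forall>j\<in>{1..l}. w \<noteq> v \<longrightarrow> labeling l c (w, j) = g (w, j)"
    by blast
  from strict_labelingE[OF g] obtain c' where c': "partition_on_grid l c'" "g = labeling l c'"
    by blast
  have "\<forall>w\<in>G. w \<noteq> v \<longrightarrow> c' w = c w"
  proof (intro ballI impI)
    fix w assume "w \<in> G" "w \<noteq> v"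
    then show "c' w = c w"
      using eq labeling_eq_iff[OF c'(1) c, of w] by (simp add: c'(2))
  qed
  then have "upmax c v \<le> c' v \<and> c' v \<le> downmin l c v"
    using partition_update_iff[OF c v, of "c' v"] c' by blast
  moreover have "P (labeling l (\<lambda>_. c' v) (v, i))"
    using P by (simp add: c'(2) labeling_def)
  ultimately show ?rhs
    by blast
next
  assume ?rhs
  then obtain m where m: "upmax c v \<le> m \<and> m \<le> downmin l c v" "P (labeling l (\<lambda>_. m) (v, i))"
    by blast
  from partition_update_iff[OF c v, of m] m(1) obtain c'
    where c': "partition_on_grid l c'" "c' v = m" "\<forall>w\<in>G. w \<noteq> v \<longrightarrow> c' w = c w"
    by blast
  show ?lhs
  proof (intro bexI[OF _ labeling_strict[OF c'(1)]] conjI)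
    show "P (labeling l c' (v, i))"
      using m(2) by (auto simp: labeling_def c'(2))
    show "\<forall>w\<in>G. \<forall>j\<in>{1..l}. w \<noteq> v \<longrightarrow> labeling l c (w, j) = labeling l c' (w, j)"
      using c'(3) by (auto simp: labeling_def)
  qed
qed

text \<open>The smaller label at \<open>i\<close> rises exactly when the entry drops below
  \<open>i\<close>, and the least admissible entry is \<open>upmax c v\<close>.\<close>

lemma raisable_iff:
  assumes "partition_on_grid l c" "v \<in> G" "1 \<le> i" "i \<le> c v"
  shows "raisable G l R (labeling l c) (v, i) \<longleftrightarrow> upmax c v < i"
proof -
  have il: "i \<le> l"
    using assms by (auto simp: partition_on_grid_def)
  have "raisable G l R (labeling l c) (v, i) \<longleftrightarrow>
      (\<exists>m. upmax c v \<le> m \<and> m \<le> downmin l c v \<and> labeling l c (v, i) < labeling l (\<lambda>_. m) (v, i))"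
    unfolding raisable_def prod.case by (rule ex_labeling_iff[OF assms(1,2)])
  moreover have "labeling l c (v, i) < labeling l (\<lambda>_. m) (v, i) \<longleftrightarrow> m < i" for m
    using assms il by (auto simp: labeling_def)
  then have "(\<exists>m. upmax c v \<le> m \<and> m \<le> downmin l c v \<and> labeling l c (v, i) < labeling l (\<lambda>_. m) (v, i))
      \<longleftrightarrow> (\<exists>m. upmax c v \<le> m \<and> m \<le> downmin l c v \<and> m < i)"
    by simp
  moreover have "\<dots> \<longleftrightarrow> upmax c v < i"
    using partition_bounds[OF assms(1,2)] by (meson le_less_trans order_refl order_trans)
  ultimately show ?thesis
    by simp
qed

text \<open>Dually, the entry has to grow to at least \<open>i\<close>, and the largest admissible
  entry is \<open>downmin l c v\<close>.\<close>

lemma lowerable_iff: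
  assumes "partition_on_grid l c" "v \<in> G" "c v < i" "i \<le> l"
  shows "lowerable G l R (labeling l c) (v, i) \<longleftrightarrow> i \<le> downmin l c v"
proof -
  have "lowerable G l R (labeling l c) (v, i) \<longleftrightarrow>
      (\<exists>m. upmax c v \<le> m \<and> m \<le> downmin l c v \<and> labeling l (\<lambda>_. m) (v, i) < labeling l c (v, i))"
    unfolding lowerable_def prod.case by (rule ex_labeling_iff[OF assms(1,2)])
  moreover have "labeling l (\<lambda>_. m) (v, i) < labeling l c (v, i) \<longleftrightarrow> i \<le> m" for m
    using assms by (auto simp: labeling_def)
  then have "(\<exists>m. upmax c v \<le> m \<and> m \<le> downmin l c v \<and> labeling l (\<lambda>_. m) (v, i) < labeling l c (v, i))
      \<longleftrightarrow> (\<exists>m. upmax c v \<le> m \<and> m \<le> downmin l c v \<and> i \<le> m)"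
    by simp
  moreover have "\<dots> \<longleftrightarrow> i \<le> downmin l c v"
    using partition_bounds[OF assms(1,2)] by (meson order_refl order_trans)
  ultimately show ?thesis
    by simp
qed

text \<open>The reflection of \<open>c v\<close> in its admissible interval, on the antidiagonal
  where \<open>k\<close> is the smaller label. On plane partitions the truncated subtraction is
  exact.\<close>

definition toggle :: "nat \<Rightarrow> int \<Rightarrow> (nat \<times> nat \<Rightarrow> nat) \<Rightarrow> nat \<times> nat \<Rightarrow> nat" where
  "toggle l k c v = (if int (rk v) = k + 1 then upmax c v + downmin l c v - c v else c v)"

text \<open>A cover joins different antidiagonals, so at most one of its ends moves, and that entry
  stays in its admissible interval.\<close>

lemma partition_toggle:
  assumes c: "partition_on_grid l c"
  shows "partition_on_grid l (toggle l k c)"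
  unfolding partition_on_grid_def
proof (intro conjI ballI impI)
  have le: "\<forall>w\<in>G. c w \<le> l"
    using c by (simp add: partition_on_grid_def)
  show "toggle l k c v \<le> l" if "v \<in> G" for v
    using partition_bounds[OF c that] by (auto simp: toggle_def)
  show "toggle l k c w \<le> toggle l k c v" if "v \<in> G" "w \<in> G" "cov v w" for v w
  proof -
    have "c w \<le> upmax c v"
      using upmax_le_iff[OF that(1), of c "upmax c v"] that by simp
    moreover have "downmin l c w \<le> c v"
      using le_downmin_iff[OF that(2) le] that by blast
    ultimately show ?thesis
      using partition_bounds[OF c that(1)] partition_bounds[OF c that(2)] cov_rk[OF that(3)]
      by (auto simp: toggle_def)
  qed
qed

text \<open>Where \<open>k\<close> is the smaller label, the free positions run from
  \<open>upmax c v + 1\<close> to \<open>downmin l c v\<close> and are split at \<open>c v\<close>;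
  exchanging the lengths of the two pieces reflects the split point. Other fibers have no free
  labels.\<close>

lemma bender_knuth_labeling:
  assumes c: "partition_on_grid l c"
  shows "bender_knuth G l R k (labeling l c) = labeling l (toggle l k c)"
proof (rule ext, clarify)
  fix x y i :: nat
  define v where "v = (x, y)"
  let ?f = "labeling l c"
  show "bender_knuth G l R k ?f ((x, y), i) = labeling l (toggle l k c) ((x, y), i)"
    unfolding v_def[symmetric]
  proof (cases "v \<in> G \<and> k = int (rk v) - 1")
    case False
    then have "v \<notin> G \<or> free_low G l R k ?f v \<union> free_high G l R k ?f v = {}"
      using grid_restriction_eq[of v] by (auto simp: free_low_def free_high_def)
    then show "bender_knuth G l R k ?f (v, i) = labeling l (toggle l k c) (v, i)"
      using False by (auto simp: bender_knuth_def Let_def labeling_def toggle_def)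
  next
    case True
    note b = partition_bounds[OF c conjunct1[OF True]]
    have R: "R v = {k, k + 1}" and rk: "int (rk v) = k + 1"
      using True grid_restriction_eq[of v] by auto
    have "{m \<in> R v. k < m} = {k + 1}"
      by (auto simp: R)
    then have next_above: "next_above (R v) k = k + 1"
      by (simp add: next_above_def)
    have low: "free_low G l R k ?f v = {upmax c v<..c v}"
      using raisable_iff[OF c] True b rk unfolding free_low_def R
      by (auto simp: labeling_def split: if_splits)
    have high: "free_high G l R k ?f v = {c v<..downmin l c v}"
      using lowerable_iff[OF c] True b rk unfolding free_high_def next_above unfolding R
      by (auto simp: labeling_def split: if_splits)
    have free: "free_low G l R k ?f v \<union> free_high G l R k ?f v = {upmax c v<..downmin l c v}"
      unfolding low high using b by auto
    have card: "card {j \<in> {upmax c v<..downmin l c v}. j \<le> i} = i - upmax c v" if "i \<le> downmin l c v"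
    proof -
      have "{j \<in> {upmax c v<..downmin l c v}. j \<le> i} = {upmax c v<..i}"
        using that by auto
      then show ?thesis
        by simp
    qed
    show "bender_knuth G l R k ?f (v, i) = labeling l (toggle l k c) (v, i)"
      unfolding bender_knuth_def prod.case Let_def free unfolding high next_above
      using True b rk card by (auto simp: labeling_def toggle_def)
  qed
qed

section \<open>Promotion as piecewise-linear rowmotion\<close>

definition pro :: "nat \<Rightarrow> (nat \<times> nat \<Rightarrow> nat) \<Rightarrow> nat \<times> nat \<Rightarrow> nat" where
  "pro l = fold (toggle l) [1..int (a + b)]"

lemma fold_bender_knuth_labeling:
  assumes "partition_on_grid l c"
  shows "fold (bender_knuth G l R) ks (labeling l c) = labeling l (fold (toggle l) ks c)"
    and "partition_on_grid l (fold (toggle l) ks c)"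
  using assms by (induction ks arbitrary: c) (auto simp: bender_knuth_labeling partition_toggle)

lemma partition_pro: "partition_on_grid l c \<Longrightarrow> partition_on_grid l (pro l c)"
  by (simp add: pro_def fold_bender_knuth_labeling)

lemma promotion_labeling:
  assumes "partition_on_grid l c"
  shows "promotion G l R (labeling l c) = labeling l (pro l c)"
proof -
  have "(\<Union>v\<in>G. R v) = {1..int (a + b)}"
  proof (intro equalityI subsetI)
    fix k assume "k \<in> {1..int (a + b)}"
    then obtain n where n: "k = int n" "1 \<le> n" "n \<le> a + b"
      by (cases k) auto
    \<comment> \<open>Every value is an allowed label on the edge \<open>y = 1\<close> or on the
      edge \<open>x = a\<close>.\<close>
    consider "n = 1" | "2 \<le> n" "n \<le> a + 1" | "a + 1 < n"
      using n by linarith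
    then have "\<exists>v\<in>G. n = rk v \<or> n + 1 = rk v"
    proof cases
      case 1
      then show ?thesis
        using a_pos b_pos by (intro bexI[of _ "(1, 1)"]) (auto simp: rk_def)
    next
      case 2
      then show ?thesis
        using b_pos by (intro bexI[of _ "(n - 1, 1)"]) (auto simp: rk_def)
    next
      case 3
      then show ?thesis
        using n a_pos by (intro bexI[of _ "(a, n - a)"]) (auto simp: rk_def)
    qed
    then obtain v where "v \<in> G" "k = int (rk v) \<or> k = int (rk v) - 1"
      using n by fastforce
    then show "k \<in> (\<Union>v\<in>G. R v)"
      using grid_restriction_eq[of v] by blast
  next
    fix k assume "k \<in> (\<Union>v\<in>G. R v)"
    then obtain v where "v \<in> G" "k \<in> R v"
      by blast
    then show "k \<in> {1..int (a + b)}"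
      using grid_restriction_eq[of v] by (auto simp: rk_def grid_def)
  qed
  moreover have "Min {1..int (a + b)} = 1" "Max {1..int (a + b)} = int (a + b)"
    using a_pos by (auto intro!: Min_eqI Max_eqI)
  ultimately show ?thesis
    using fold_bender_knuth_labeling[OF assms] by (simp add: promotion_def pro_def)
qed

text \<open>\<open>toggle l k\<close> acts on rank \<open>k + 1\<close>, so the toggles sweep
  upwards: when \<open>v\<close> is reached, its lower neighbours are final and its upper neighbours
  still unchanged.\<close>

lemma pro_step:
  assumes c: "partition_on_grid l c" and "v \<in> G"
  shows "pro l c v + c v = downmin l (pro l c) v + upmax c v"
proof -
  define s where "s n = fold (toggle l) [1..int n] c" for n
  have s_Suc: "s (Suc n) = toggle l (int (Suc n)) (s n)" for n
    by (simp add: s_def upto_rec2[of 1 "1 + int n"])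
  have part: "partition_on_grid l (s n)" for n
    unfolding s_def by (rule fold_bender_knuth_labeling[OF c])
  have high: "s n v = c v" if "n + 1 < rk v" for n v
    using that
  proof (induction n)
    case 0
    then show ?case
      by (simp add: s_def)
  next
    case (Suc n)
    then show ?case
      by (simp add: s_Suc toggle_def)
  qed
  have "s n v + c v = downmin l (s n) v + upmax c v" if "v \<in> G" "rk v \<le> n + 1" for n v
    using that
  proof (induction n)
    case 0
    then show ?case
      by (auto simp: rk_def grid_def)
  next
    case (Suc n)
    \<comment> \<open>This toggle acts on rank \<open>n + 2\<close>, while the lower neighbours have
      rank at most \<open>n + 1\<close>.\<close>
    have down: "downmin l (s (Suc n)) v = downmin l (s n) v"
    proof (rule downmin_cong)
      fix w assume "cov w v"
      then show "s (Suc n) w = s n w"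
        using cov_rk[of w v] Suc.prems by (simp add: s_Suc toggle_def)
    qed
    show ?case
    proof (cases "rk v = n + 2")
      case True
      have "upmax (s n) v = upmax c v"
        using True by (intro upmax_cong high) (auto dest: cov_rk)
      moreover have "s n v = c v"
        using True by (intro high) auto
      ultimately have "s (Suc n) v = upmax c v + downmin l (s n) v - c v" "c v \<le> downmin l (s n) v"
        using True partition_bounds[OF part Suc.prems(1), of n] by (auto simp: s_Suc toggle_def)
      then show ?thesis
        unfolding down by simp
    next
      case False
      then have "s (Suc n) v = s n v"
        by (simp add: s_Suc toggle_def)
      then show ?thesis
        unfolding down using Suc False by simp
    qed
  qed
  from this[of v "a + b"] assms(2) show ?thesis
    by (auto simp: s_def pro_def rk_def grid_def)
qed

text \<open>The embedding of natural numbers into the reals respects minima and maxima, so iterated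
  \<open>pro\<close> is an instance of \<open>tropical_evolution\<close>.\<close>

lemma pro_reciprocity:
  assumes c: "partition_on_grid l c" and "(x, y) \<in> G"
  shows "(pro l ^^ t) c (x, y) + (pro l ^^ (t + x + y - 1)) c (a + 1 - x, b + 1 - y) = l"
proof -
  have part: "partition_on_grid l ((pro l ^^ t) c)" for t
    by (induction t) (simp_all add: c partition_pro)
  interpret tropical_evolution a b "real l" "\<lambda>t v. real ((pro l ^^ t) c v)"
  proof
    show "0 \<le> real ((pro l ^^ t) c v) \<and> real ((pro l ^^ t) c v) \<le> real l" if "v \<in> G" for v t
      using part[of t] that by (simp add: partition_on_grid_def)
    show "real ((pro l ^^ Suc t) c v) + real ((pro l ^^ t) c v) =
        downmin (real l) (\<lambda>v. real ((pro l ^^ Suc t) c v)) v + upmax (\<lambda>v. real ((pro l ^^ t) c v)) v"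
      if "v \<in> G" for v t
    proof -
      have "downmin (real l) (\<lambda>v. real (g v)) v = real (downmin l g v)"
        "upmax (\<lambda>v. real (g v)) v = real (upmax g v)" for g
        by (auto simp: downmin_def upmax_def of_nat_min of_nat_max split: prod.split)
      then show ?thesis
        using pro_step[OF part that, of t] by (simp flip: of_nat_add)
    qed
  qed
  have "real ((pro l ^^ t) c (x, y) + (pro l ^^ (t + x + y - 1)) c (a + 1 - x, b + 1 - y)) = real l"
    using tropical_reciprocity[OF assms(2), of t] by simp
  then show ?thesis
    by (simp only: of_nat_eq_iff)
qed

end

theorem theorem3p31:
  fixes a b l x\<^sub>1 y\<^sub>1 z\<^sub>1 x\<^sub>2 y\<^sub>2 z\<^sub>2 :: nat
    and f :: "(nat \<times> nat) \<times> nat \<Rightarrow> int"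
  assumes "a > 0" and "b > 0" and "l > 0"
    and "f \<in> strict_labelings (grid a b) l (grid_restriction a b)"
    and "((x\<^sub>1, y\<^sub>1), z\<^sub>1) \<in> grid a b \<times> {1..l}"
    and "((x\<^sub>2, y\<^sub>2), z\<^sub>2) \<in> grid a b \<times> {1..l}"
    and "x\<^sub>2 = a + 1 - x\<^sub>1" and "y\<^sub>2 = b + 1 - y\<^sub>1" and "z\<^sub>2 = l + 1 - z\<^sub>1"
  shows "label_dist a b l f ((x\<^sub>2, y\<^sub>2), z\<^sub>2) =
         image_mset (\<lambda>m. int (a + b + 1) - m) (label_dist a b l f ((x\<^sub>1, y\<^sub>1), z\<^sub>1))"
proof -
  interpret rectangle a b
    using assms by unfold_locales auto
  obtain c where c: "partition_on_grid l c" "f = labeling l c"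
    using strict_labelingE[OF assms(4)] .
  define C where "C t = (pro l ^^ t) c" for t
  define h where "h v t = labeling l (C t) v" for v t
  have part: "partition_on_grid l (C t)" for t
    by (induction t) (simp_all add: C_def c partition_pro)
  have "(promotion (grid a b) l R ^^ t) f = labeling l (C t)" for t
  proof (induction t)
    case (Suc t)
    then show ?case
      using promotion_labeling[OF part, of t] by (simp add: C_def)
  qed (simp add: C_def c)
  moreover have "{0..a + b - 1} = {0..<a + b}"
    using assms(1) by auto
  ultimately have dist: "label_dist a b l f v = image_mset (h v) (mset_set {0..<a + b})" for v
    by (simp add: label_dist_def h_def[abs_def])
  have v\<^sub>1: "(x\<^sub>1, y\<^sub>1) \<in> G" "z\<^sub>1 \<in> {1..l}" and v\<^sub>2: "(x\<^sub>2, y\<^sub>2) \<in> G" "z\<^sub>2 \<in> {1..l}"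
    using assms(5,6) by (simp_all only: mem_Times_iff fst_conv snd_conv)
  then have antipode: "x\<^sub>1 + x\<^sub>2 = a + 1" "y\<^sub>1 + y\<^sub>2 = b + 1" "z\<^sub>1 + z\<^sub>2 = l + 1"
    using assms(7-9) by simp_all
  have rec: "C t (x, y) + C (t + x + y - 1) (x', y') = l"
    if "(x, y) \<in> G" "x + x' = a + 1" "y + y' = b + 1" for t x y x' y'
  proof -
    have "x' = a + 1 - x" "y' = b + 1 - y"
      using that by simp_all
    then show ?thesis
      using pro_reciprocity[OF c(1) that(1), of t] by (simp only: C_def)
  qed
  have rec1: "C t (x\<^sub>1, y\<^sub>1) + C (t + x\<^sub>1 + y\<^sub>1 - 1) (x\<^sub>2, y\<^sub>2) = l" for t
    using v\<^sub>1(1) antipode(1,2) by (rule rec)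
  have rec2: "C t (x\<^sub>2, y\<^sub>2) + C (t + x\<^sub>2 + y\<^sub>2 - 1) (x\<^sub>1, y\<^sub>1) = l" for t
    using v\<^sub>2(1) antipode(1,2) by (intro rec) simp_all
  \<comment> \<open>Reciprocity to the antipode and back: the two delays add up to
    \<open>a + b\<close>.\<close>
  have "C (t + (a + b)) (x\<^sub>2, y\<^sub>2) = C t (x\<^sub>2, y\<^sub>2)" for t
  proof -
    have "t + x\<^sub>2 + y\<^sub>2 - 1 + x\<^sub>1 + y\<^sub>1 - 1 = t + (a + b)"
      using antipode(1,2) v\<^sub>2(1) by simp
    then show ?thesis
      using rec2[of t] rec1[of "t + x\<^sub>2 + y\<^sub>2 - 1"] by simp
  qed
  then have periodic: "h ((x\<^sub>2, y\<^sub>2), z\<^sub>2) (t + (a + b)) = h ((x\<^sub>2, y\<^sub>2), z\<^sub>2) t" for t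
    by (simp add: h_def labeling_def)
  define s where "s = x\<^sub>1 + y\<^sub>1 - 1"
  have "h ((x\<^sub>2, y\<^sub>2), z\<^sub>2) (t + s) = int (a + b + 1) - h ((x\<^sub>1, y\<^sub>1), z\<^sub>1) t" for t
  proof -
    have "t + x\<^sub>1 + y\<^sub>1 - 1 = t + s"
      using v\<^sub>1(1) by (simp add: s_def)
    \<comment> \<open>As \<open>z\<^sub>1 + z\<^sub>2 = l + 1\<close>, complementing the entry in
      \<open>l\<close> makes a smaller label at one antipode face a larger one at the other. The
      ranks add up to \<open>a + b + 2\<close>, hence the labels to
      \<open>a + b + 1\<close>.\<close>
    then have "z\<^sub>2 \<le> C (t + s) (x\<^sub>2, y\<^sub>2) \<longleftrightarrow> \<not> z\<^sub>1 \<le> C t (x\<^sub>1, y\<^sub>1)"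
      using rec1[of t] antipode(3) by auto
    moreover have "int (rk (x\<^sub>2, y\<^sub>2)) = int (a + b + 2) - int (rk (x\<^sub>1, y\<^sub>1))"
      using antipode(1,2) by (simp add: rk_def)
    ultimately show ?thesis
      using v\<^sub>1 v\<^sub>2 by (simp add: h_def labeling_def del: grid_iff)
  qed
  then have "image_mset (\<lambda>m. int (a + b + 1) - m) (label_dist a b l f ((x\<^sub>1, y\<^sub>1), z\<^sub>1)) =
      image_mset (\<lambda>t. h ((x\<^sub>2, y\<^sub>2), z\<^sub>2) (t + s)) (mset_set {0..<a + b})"
    by (simp add: dist image_mset.compositionality comp_def)
  \<comment> \<open>The delay \<open>s\<close> does not matter over a full period.\<close>
  also have "\<dots> = label_dist a b l f ((x\<^sub>2, y\<^sub>2), z\<^sub>2)"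
    unfolding dist by (rule image_mset_shift) (rule periodic)
  finally show ?thesis
    by simp
qed

end
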